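(* Let $u$ be a finite game and let $H$ be a strongly connected component of its response graph. Then the content of $H$ is contained in $[H]$, the chain component of the replicator flow containing $H$.
   Context: Games. A (finite) game has players $1,\dots,N$, finite non-empty strategy sets $S_1,\dots,S_N$ and a utility function $u:Z\to\mathbb{R}^N$, where $Z=\prod_{i=1}^N S_i$ is the set of (pure) profiles. Two profiles are $i$-comparable if they differ exactly in the strategy of player $i$. The response graph is the directed graph with node set $Z$ and an arc $p\to q$ if and only if $p,q$ are $i$-comparable for some $i$ and $u_i(p)\le u_i(q)$. The strategy space is $X=\prod_{i=1}^N\Delta_{|S_i|}$, where $\Delta_{|S_i|}$ is the simplex of probability distributions on $S_i$; its elements are mixed profiles. For $x\in X$, $x^i_s$ is the probability player $i$ gives to $s\in S_i$. Pure profiles are identified with vertices of $X$. The expected utility is $\mathbb{U}(x)=\sum_{q\in Z}u(q)\prod_{i=1}^N x^i_{q_i}$, and $\mathbb{U}_p(s;\bar x_{-p})$ denotes player $p$'s expected utility when $p$ plays $s$ and the others play according to $x$. Content. For a set $W\subseteq Z$ of pure profiles, $\mathrm{content}(W)$ is the set of all mixed profiles $x\in X$ such that every pure profile in the support of $x$ (i.e. every $q\in Z$ with $x^i_{q_i}>0$ for all $i$) lies in $W$. Replicator flow. The replicator flow $\phi:X\times\mathbb{R}\to X$ is the flow of the ODE $\dot x^p_s=x^p_s\bigl(\mathbb{U}_p(s;\bar x_{-p})-\sum_{t\in S_p}x^p_t\,\mathbb{U}_p(t;\bar x_{-p})\bigr)$. Chains. Let $\mathbf{d}$ be the Euclidean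 metric on $X$. For $\epsilon,T>0$, an $(\epsilon,T)$-chain from $x$ to $y$ is a finite sequence $x=x_1,x_2,\dots,x_n=y$ with $n\ge 2$ and times $t_1,\dots,t_{n-1}\ge T$ such that $\mathbf{d}(\phi(x_i,t_i),x_{i+1})<\epsilon$ for $1\le i\le n-1$. There is a pseudo-orbit from $x$ to $y$ if there is an $(\epsilon,T)$-chain from $x$ to $y$ for all $\epsilon>0$ and $T>0$. Points $x,y$ are chain equivalent if there are pseudo-orbits from $x$ to $y$ and from $y$ to $x$; $x$ is chain recurrent if it is chain equivalent to itself. Chain equivalence is an equivalence relation on the chain recurrent points; its classes are the chain components. All pure profiles of a strongly connected component $H$ of the response graph lie in a single chain component, denoted $[H]$. *)

theory Defs
  imports "HOL-Analysis.Analysis" "Graph_Theory.Graph_Theory"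
begin

text \<open>
  Players are the elements of a finite type \<open>'i\<close>; player \<open>i\<close> has the strategy set
  \<open>S i\<close>, a subset of a finite type \<open>'s\<close> that is shared by the players, so that different players
  may have different numbers of strategies. Only the values of the utility function \<open>u\<close> on
  \<open>pure_profiles S\<close> are used.
\<close>

definition pure_profiles :: "('i \<Rightarrow> 's set) \<Rightarrow> ('i \<Rightarrow> 's) set" where
  "pure_profiles S = {q. \<forall>i. q i \<in> S i}"

definition comparable :: "'i \<Rightarrow> ('i \<Rightarrow> 's) \<Rightarrow> ('i \<Rightarrow> 's) \<Rightarrow> bool" where
  "comparable i p q \<longleftrightarrow> p i \<noteq> q i \<and> (\<forall>j. j \<noteq> i \<longrightarrow> p j = q j)"

definition response_graph ::
  "('i::finite \<Rightarrow> 's set) \<Rightarrow> (('i \<Rightarrow> 's) \<Rightarrow> real ^ 'i) \<Rightarrow> ('i \<Rightarrow> 's) pair_pre_digraph" where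
  "response_graph S u =
    \<lparr> pverts = pure_profiles S,
      parcs = {(p, q). p \<in> pure_profiles S \<and> q \<in> pure_profiles S \<and>
                       (\<exists>i. comparable i p q \<and> u p $ i \<le> u q $ i)} \<rparr>"

text \<open>
  A mixed profile is a vector in \<open>real ^ 's ^ 'i\<close>, with entry \<open>x $ i $ s\<close> the probability that
  player \<open>i\<close> gives to \<open>s\<close> and with zero entries for \<open>s \<notin> S i\<close>. The library metric on
  \<open>real ^ 's ^ 'i\<close> is the Euclidean one on all entries.
\<close>

definition mixed_profiles :: "('i::finite \<Rightarrow> 's::finite set) \<Rightarrow> (real ^ 's ^ 'i) set" where
  "mixed_profiles S =
    {x. \<forall>i. (\<forall>s\<in>S i. 0 \<le> x $ i $ s) \<and> (\<forall>s. s \<notin> S i \<longrightarrow> x $ i $ s = 0) \<and>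
            (\<Sum>s\<in>S i. x $ i $ s) = 1}"

definition pure_vertex :: "('i::finite \<Rightarrow> 's::finite) \<Rightarrow> real ^ 's ^ 'i" where
  "pure_vertex q = (\<chi> i. axis (q i) 1)"

definition profile_content ::
  "('i::finite \<Rightarrow> 's::finite set) \<Rightarrow> ('i \<Rightarrow> 's) set \<Rightarrow> (real ^ 's ^ 'i) set" where
  "profile_content S W =
    {x \<in> mixed_profiles S. \<forall>q\<in>pure_profiles S. (\<forall>i. 0 < x $ i $ q i) \<longrightarrow> q \<in> W}"

definition expected_utility ::
  "('i::finite \<Rightarrow> 's::finite set) \<Rightarrow> (('i \<Rightarrow> 's) \<Rightarrow> real ^ 'i) \<Rightarrow> real ^ 's ^ 'i \<Rightarrow> real ^ 'i" where
  "expected_utility S u x = (\<Sum>q\<in>pure_profiles S. (\<Prod>i\<in>UNIV. x $ i $ q i) *\<^sub>R u q)"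

text \<open>The expected utility of player \<open>p\<close> for playing \<open>s\<close> while the others play according to \<open>x\<close>.\<close>

definition strategy_utility ::
  "('i::finite \<Rightarrow> 's::finite set) \<Rightarrow> (('i \<Rightarrow> 's) \<Rightarrow> real ^ 'i) \<Rightarrow> 'i \<Rightarrow> 's \<Rightarrow> real ^ 's ^ 'i \<Rightarrow> real" where
  "strategy_utility S u p s x =
    expected_utility S u (\<chi> i. if i = p then axis s 1 else x $ i) $ p"

definition replicator_field ::
  "('i::finite \<Rightarrow> 's::finite set) \<Rightarrow> (('i \<Rightarrow> 's) \<Rightarrow> real ^ 'i) \<Rightarrow> real ^ 's ^ 'i \<Rightarrow> real ^ 's ^ 'i" where
  "replicator_field S u x =
    (\<chi> p s. x $ p $ s *
      (strategy_utility S u p s x - (\<Sum>t\<in>S p. x $ p $ t * strategy_utility S u p t x)))"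

text \<open>
  The flow is characterised on the strategy space only; values \<open>\<phi> x t\<close> for \<open>x\<close> outside
  \<open>mixed_profiles S\<close> are unconstrained.
\<close>

definition replicator_flow ::
  "('i::finite \<Rightarrow> 's::finite set) \<Rightarrow> (('i \<Rightarrow> 's) \<Rightarrow> real ^ 'i) \<Rightarrow>
   (real ^ 's ^ 'i \<Rightarrow> real \<Rightarrow> real ^ 's ^ 'i) \<Rightarrow> bool" where
  "replicator_flow S u \<phi> \<longleftrightarrow>
    continuous_on (mixed_profiles S \<times> UNIV) (\<lambda>(x, t). \<phi> x t) \<and>
    (\<forall>x\<in>mixed_profiles S.
      \<phi> x 0 = x \<and>
      (\<forall>s t. \<phi> x (s + t) = \<phi> (\<phi> x s) t) \<and>
      (\<forall>t. \<phi> x t \<in> mixed_profiles S \<and>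
           (\<phi> x has_vector_derivative replicator_field S u (\<phi> x t)) (at t)))"

text \<open>
  All points of a chain are required to lie in the phase space \<open>X\<close> of the flow, which is a
  subset of the ambient metric space.
\<close>

definition is_chain ::
  "'a::metric_space set \<Rightarrow> ('a \<Rightarrow> real \<Rightarrow> 'a) \<Rightarrow> real \<Rightarrow> real \<Rightarrow> 'a \<Rightarrow> 'a \<Rightarrow> bool" where
  "is_chain X \<phi> \<epsilon> T x y \<longleftrightarrow>
    (\<exists>(n::nat) (z :: nat \<Rightarrow> 'a) (t :: nat \<Rightarrow> real).
       2 \<le> n \<and> z 1 = x \<and> z n = y \<and> (\<forall>i\<in>{1..n}. z i \<in> X) \<and>
       (\<forall>i\<in>{1..n - 1}. T \<le> t i \<and> dist (\<phi> (z i) (t i)) (z (i + 1)) < \<epsilon>))"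

definition pseudo_orbit :: "'a::metric_space set \<Rightarrow> ('a \<Rightarrow> real \<Rightarrow> 'a) \<Rightarrow> 'a \<Rightarrow> 'a \<Rightarrow> bool" where
  "pseudo_orbit X \<phi> x y \<longleftrightarrow> (\<forall>\<epsilon>>0. \<forall>T>0. is_chain X \<phi> \<epsilon> T x y)"

definition chain_equivalent :: "'a::metric_space set \<Rightarrow> ('a \<Rightarrow> real \<Rightarrow> 'a) \<Rightarrow> 'a \<Rightarrow> 'a \<Rightarrow> bool" where
  "chain_equivalent X \<phi> x y \<longleftrightarrow> pseudo_orbit X \<phi> x y \<and> pseudo_orbit X \<phi> y x"

definition chain_recurrent :: "'a::metric_space set \<Rightarrow> ('a \<Rightarrow> real \<Rightarrow> 'a) \<Rightarrow> 'a set" where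
  "chain_recurrent X \<phi> = {x \<in> X. chain_equivalent X \<phi> x x}"

definition chain_components :: "'a::metric_space set \<Rightarrow> ('a \<Rightarrow> real \<Rightarrow> 'a) \<Rightarrow> 'a set set" where
  "chain_components X \<phi> =
    chain_recurrent X \<phi> //
      {(x, y). x \<in> chain_recurrent X \<phi> \<and> y \<in> chain_recurrent X \<phi> \<and> chain_equivalent X \<phi> x y}"

text \<open>
  The chain component \<open>[H]\<close>; for \<open>H\<close> a strongly connected component of the response graph
  and \<open>\<phi>\<close> the replicator flow there is exactly one chain component containing \<open>H\<close>.
\<close>

definition chain_component_of ::
  "('i::finite \<Rightarrow> 's::finite set) \<Rightarrow> (real ^ 's ^ 'i \<Rightarrow> real \<Rightarrow> real ^ 's ^ 'i) \<Rightarrow>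
   ('i \<Rightarrow> 's) set \<Rightarrow> (real ^ 's ^ 'i) set" where
  "chain_component_of S \<phi> H =
    (THE C. C \<in> chain_components (mixed_profiles S) \<phi> \<and> pure_vertex ` H \<subseteq> C)"

end

theory Submission
  imports Defs
begin

text \<open>
  Along an arc of the response graph the replicator flow on the corresponding edge never decreases
  the probability of the better strategy, so small jumps lead from one end to the other. It remains to
  connect every point \<open>x\<close> of the content to some vertex of \<open>H\<close>, in both directions; the second
  follows from the first by time reversal, which turns \<open>u\<close> into \<open>- u\<close>. By induction on the support it
  suffices to reach the boundary of the face whose relative interior contains \<open>x\<close>.

  In the coordinates \<open>ln (x\<^sub>s / x\<^sub>a)\<close>, with one reference strategy \<open>a\<close> per player, the velocity of a
  player depends only on the other players. Hence the Euler steps of a single player are shears, and after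
  rounding to a lattice they are still injective. Their compositions approximate the time-\<open>T\<close> map
  uniformly by an injective map \<open>P\<close> of the lattice. A finite set of lattice points that is closed under
  applying \<open>P\<close> and then moving to a lattice neighbour would be permuted by \<open>P\<close>, hence closed under taking
  neighbours, which is impossible. So pseudo-orbits leave every bounded set, that is, they approach the
  boundary. This discrete argument takes the place of volume conservation.
\<close>

section \<open>Lattice approximation of shear fields\<close>

text \<open>The abstract form of the replicator field in logarithmic coordinates. By
  \<open>own_independent\<close> the Euler step of one player is a shear. The norm in
  \<open>lipschitz\<close> is the supremum over all coordinates, with \<open>r\<close> any bound on
  the distance.\<close>

locale shear_field =
  fixes G :: "('i::finite \<Rightarrow> 's \<Rightarrow> real) \<Rightarrow> 'i \<Rightarrow> 's \<Rightarrow> real" and B L :: real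
  assumes own_independent: "(\<And>j. j \<noteq> i \<Longrightarrow> y j = z j) \<Longrightarrow> G y i = G z i"
    and bounded: "\<bar>G y i s\<bar> \<le> B"
    and lipschitz: "(\<And>j t. \<bar>y j t - z j t\<bar> \<le> r) \<Longrightarrow> \<bar>G y i s - G z i s\<bar> \<le> L * r"
    and B_nonneg: "0 \<le> B" and L_nonneg: "0 \<le> L"
begin

definition grid :: "real \<Rightarrow> ('i \<Rightarrow> 's \<Rightarrow> int) \<Rightarrow> 'i \<Rightarrow> 's \<Rightarrow> real" where
  "grid \<delta> k = (\<lambda>i s. \<delta> * of_int (k i s))"

definition shear :: "real \<Rightarrow> real \<Rightarrow> 'i \<Rightarrow> ('i \<Rightarrow> 's \<Rightarrow> int) \<Rightarrow> 'i \<Rightarrow> 's \<Rightarrow> int" where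
  "shear h \<delta> i k = k(i := \<lambda>s. k i s + \<lfloor>h * G (grid \<delta> k) i s / \<delta>\<rfloor>)"

text \<open>The displacement of player \<open>i\<close> is computed from coordinates that the step
  leaves alone, so two configurations with the same image were displaced by the same integers.
  Taking floors does not disturb this.\<close>

lemma inj_shear: "inj (shear h \<delta> i)"
proof (rule injI)
  fix k l assume eq: "shear h \<delta> i k = shear h \<delta> i l"
  have other: "k j = l j" if "j \<noteq> i" for j
    using fun_cong[OF eq, of j] that by (simp add: shear_def)
  then have "G (grid \<delta> k) i = G (grid \<delta> l) i"
    by (intro own_independent) (simp add: grid_def)
  then have "k i = l i"
    using fun_cong[OF eq, of i] by (simp add: shear_def fun_eq_iff)
  with other show "k = l" by (metis ext)
qed

lemma shear_error:
  assumes "0 < \<delta>"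
  shows "\<bar>\<delta> * shear h \<delta> i k i s - (\<delta> * k i s + h * G (grid \<delta> k) i s)\<bar> \<le> \<delta>"
proof -
  define v where "v = h * G (grid \<delta> k) i s / \<delta>"
  have v: "h * G (grid \<delta> k) i s = \<delta> * v" using assms by (simp add: v_def)
  have "shear h \<delta> i k i s = k i s + \<lfloor>v\<rfloor>" by (simp add: shear_def v_def)
  then have "\<delta> * shear h \<delta> i k i s - (\<delta> * k i s + h * G (grid \<delta> k) i s) = - (\<delta> * (v - \<lfloor>v\<rfloor>))"
    unfolding v by (simp add: algebra_simps)
  moreover have "0 \<le> v - \<lfloor>v\<rfloor>" "v - \<lfloor>v\<rfloor> \<le> 1" by linarith+
  ultimately show ?thesis using assms by (simp add: abs_mult mult_left_le)
qed

lemma shear_other: "j \<noteq> i \<Longrightarrow> shear h \<delta> i k j = k j"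
  by (simp add: shear_def)

text \<open>Here \<open>k\<^sub>0\<close> is the configuration at the start of a sweep over the
  players, and in \<open>k\<close> those outside \<open>ps\<close> may already have moved. Each
  moves once, by at most \<open>h * B + \<delta>\<close>, so evaluating \<open>G\<close> at the
  partly updated configuration costs at most \<open>h * (L * (h * B + \<delta>))\<close>; rounding
  costs a further \<open>\<delta>\<close>.\<close>

lemma fold_shear_error:
  fixes \<delta> h :: real
  assumes "0 < \<delta>" "0 \<le> h" "distinct ps"
    and "\<And>j t. \<bar>\<delta> * k j t - \<delta> * k\<^sub>0 j t\<bar> \<le> h * B + \<delta>"
    and "\<And>j. j \<in> set ps \<Longrightarrow> k j = k\<^sub>0 j"
  shows "(i \<in> set ps \<longrightarrow> \<bar>\<delta> * fold (shear h \<delta>) ps k i s - (\<delta> * k\<^sub>0 i s + h * G (grid \<delta> k\<^sub>0) i s)\<bar>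
             \<le> h * (L * (h * B + \<delta>)) + \<delta>)
       \<and> (i \<notin> set ps \<longrightarrow> fold (shear h \<delta>) ps k i s = k i s)"
  using assms(3-)
proof (induction ps arbitrary: k)
  case Nil
  then show ?case by simp
next
  case (Cons p ps)
  let ?k = "shear h \<delta> p k"
  have own: "k p = k\<^sub>0 p" using Cons.prems by simp
  have step: "\<bar>\<delta> * ?k p s - (\<delta> * k\<^sub>0 p s + h * G (grid \<delta> k) p s)\<bar> \<le> \<delta>" for s
    using shear_error[OF \<open>0 < \<delta>\<close>, of h p k s] own by simp
  have close: "\<bar>\<delta> * ?k j t - \<delta> * k\<^sub>0 j t\<bar> \<le> h * B + \<delta>" for j t
  proof (cases "j = p")
    case True
    have "\<bar>h * G (grid \<delta> k) p t\<bar> \<le> h * B"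
      using bounded \<open>0 \<le> h\<close> by (simp add: abs_mult mult_left_mono)
    then show ?thesis using step[of t] unfolding True by linarith
  next
    case False
    then show ?thesis using Cons.prems(2) by (simp add: shear_other)
  qed
  have agree: "?k j = k\<^sub>0 j" if "j \<in> set ps" for j
  proof -
    have "j \<noteq> p" using that Cons.prems(1) by auto
    then show ?thesis using that Cons.prems(3) by (simp add: shear_other)
  qed
  have IH: "(i \<in> set ps \<longrightarrow> \<bar>\<delta> * fold (shear h \<delta>) ps ?k i s - (\<delta> * k\<^sub>0 i s + h * G (grid \<delta> k\<^sub>0) i s)\<bar>
             \<le> h * (L * (h * B + \<delta>)) + \<delta>)
       \<and> (i \<notin> set ps \<longrightarrow> fold (shear h \<delta>) ps ?k i s = ?k i s)"
    using Cons.IH Cons.prems(1) close agree by simp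
  show ?case
  proof (cases "i = p")
    case True
    have "\<bar>G (grid \<delta> k) p s - G (grid \<delta> k\<^sub>0) p s\<bar> \<le> L * (h * B + \<delta>)"
      by (rule lipschitz) (use Cons.prems(2) in \<open>simp add: grid_def\<close>)
    then have "\<bar>h * G (grid \<delta> k) p s - h * G (grid \<delta> k\<^sub>0) p s\<bar> \<le> h * (L * (h * B + \<delta>))"
      using \<open>0 \<le> h\<close> by (metis abs_mult abs_of_nonneg mult_left_mono right_diff_distrib)
    then have "\<bar>\<delta> * ?k p s - (\<delta> * k\<^sub>0 p s + h * G (grid \<delta> k\<^sub>0) p s)\<bar> \<le> h * (L * (h * B + \<delta>)) + \<delta>"
      using step[of s] by linarith
    then show ?thesis using IH True Cons.prems(1) by simp
  next
    case False
    then show ?thesis using IH by (simp add: shear_other)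
  qed
qed

definition players :: "'i list" where
  "players = (SOME ps. distinct ps \<and> set ps = UNIV)"

lemma players: "distinct players" "set players = UNIV"
proof -
  have "\<exists>ps. distinct ps \<and> set ps = (UNIV :: 'i set)"
    using finite_distinct_list[of "UNIV :: 'i set"] by auto
  from someI_ex[OF this] show "distinct players" "set players = UNIV"
    unfolding players_def by auto
qed

definition lattice_step :: "real \<Rightarrow> real \<Rightarrow> ('i \<Rightarrow> 's \<Rightarrow> int) \<Rightarrow> 'i \<Rightarrow> 's \<Rightarrow> int" where
  "lattice_step h \<delta> = fold (shear h \<delta>) players"

lemma inj_lattice_step: "inj (lattice_step h \<delta>)"
proof -
  have "inj (fold (shear h \<delta>) ps)" for ps
  proof (induction ps)
    case (Cons p ps)
    then show ?case unfolding fold.simps by (rule inj_compose[OF _ inj_shear])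
  qed simp
  then show ?thesis by (simp add: lattice_step_def)
qed

lemma lattice_step_error:
  fixes \<delta> h :: real
  assumes "0 < \<delta>" "0 \<le> h"
  shows "\<bar>\<delta> * lattice_step h \<delta> k i s - (\<delta> * k i s + h * G (grid \<delta> k) i s)\<bar>
    \<le> h * (L * (h * B + \<delta>)) + \<delta>"
  using fold_shear_error[OF assms players(1), of k k i s] assms B_nonneg
  by (simp add: players(2) lattice_step_def)

text \<open>Zero velocity has floor zero, so rounding cannot move such a coordinate either.\<close>

lemma lattice_step_fixed:
  assumes "\<And>y. G y i s = 0"
  shows "lattice_step h \<delta> k i s = k i s"
proof -
  have "fold (shear h \<delta>) ps k i s = k i s" for ps
  proof (induction ps arbitrary: k)
    case (Cons p ps)
    have "shear h \<delta> p k i s = k i s" by (cases "i = p") (use assms in \<open>auto simp: shear_def\<close>)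
    with Cons show ?case by simp
  qed simp
  then show ?thesis by (simp add: lattice_step_def)
qed

section \<open>Error of the lattice steps against exact solutions\<close>

definition solution :: "real \<Rightarrow> (real \<Rightarrow> 'i \<Rightarrow> 's \<Rightarrow> real) \<Rightarrow> bool" where
  "solution T y \<longleftrightarrow>
    (\<forall>i s t. 0 \<le> t \<longrightarrow> t \<le> T \<longrightarrow> ((\<lambda>t. y t i s) has_real_derivative G (y t) i s) (at t))"

lemma solution_increment:
  assumes "solution T y" "0 \<le> a" "a \<le> b" "b \<le> T"
  shows "\<exists>c. a \<le> c \<and> c \<le> b \<and> y b i s - y a i s = (b - a) * G (y c) i s"
proof (cases "a = b")
  case False
  then have "\<exists>c>a. c < b \<and> y b i s - y a i s = (b - a) * G (y c) i s"
    using assms by (intro MVT2) (auto simp: solution_def)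
  then show ?thesis by (metis less_imp_le)
qed auto

lemma solution_local_error:
  assumes y: "solution T y" and "0 \<le> a" "0 \<le> h" "a + h \<le> T"
  shows "\<bar>y (a + h) i s - (y a i s + h * G (y a) i s)\<bar> \<le> h * (L * (h * B))"
proof -
  obtain c where c: "a \<le> c" "c \<le> a + h" and eq: "y (a + h) i s - y a i s = h * G (y c) i s"
    using solution_increment[OF y, of a "a + h" i s] assms by auto
  \<comment> \<open>The time \<open>c\<close> depends on \<open>i\<close> and \<open>s\<close>. A
    second use of the mean value theorem bounds the movement of every coordinate up to
    \<open>c\<close>, and then the Lipschitz bound compares \<open>G\<close> at the two
    times.\<close>
  have "\<bar>y c j t - y a j t\<bar> \<le> h * B" for j t
  proof -
    obtain d where "y c j t - y a j t = (c - a) * G (y d) j t"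
      using solution_increment[OF y, of a c j t] assms c by auto
    moreover have "\<bar>(c - a) * G (y d) j t\<bar> \<le> h * B"
      unfolding abs_mult using bounded c assms by (intro mult_mono) auto
    ultimately show ?thesis by simp
  qed
  then have "\<bar>G (y c) i s - G (y a) i s\<bar> \<le> L * (h * B)" by (rule lipschitz)
  then have "\<bar>h * (G (y c) i s - G (y a) i s)\<bar> \<le> h * (L * (h * B))"
    using \<open>0 \<le> h\<close> by (simp add: abs_mult mult_left_mono)
  then show ?thesis using eq by (simp add: algebra_simps)
qed

text \<open>A discrete Gronwall estimate: one step multiplies the accumulated error by at most
  \<open>1 + h * L\<close> and adds the local errors of the Euler step and of the lattice
  step.\<close>

lemma lattice_steps_error:
  assumes y: "solution T y" and y0: "y 0 = grid \<delta> k" and \<delta>: "0 < \<delta>" and h: "0 \<le> h"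
    and "real n * h \<le> T"
  shows "\<bar>\<delta> * (lattice_step h \<delta> ^^ n) k i s - y (real n * h) i s\<bar>
    \<le> real n * (1 + h * L) ^ n * (h * (L * (h * B)) + h * (L * (h * B + \<delta>)) + \<delta>)"
  using assms(5)
proof (induction n arbitrary: i s)
  case 0
  then show ?case by (simp add: y0 grid_def)
next
  case (Suc n)
  define e where "e = h * (L * (h * B)) + h * (L * (h * B + \<delta>)) + \<delta>"
  have e: "0 \<le> e" using h \<delta> B_nonneg L_nonneg by (simp add: e_def)
  define k' where "k' = (lattice_step h \<delta> ^^ n) k"
  define E where "E = real n * (1 + h * L) ^ n * e"
  have nh: "real n * h \<le> T" "real n * h + h \<le> T"
    using Suc.prems h by (auto simp: algebra_simps)
  have IH: "\<bar>\<delta> * k' i s - y (real n * h) i s\<bar> \<le> E" for i s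
    using Suc.IH[OF nh(1)] by (simp add: E_def e_def k'_def)
  have "\<bar>G (grid \<delta> k') i s - G (y (real n * h)) i s\<bar> \<le> L * E"
    by (rule lipschitz) (use IH in \<open>simp add: grid_def\<close>)
  then have 1: "\<bar>h * G (grid \<delta> k') i s - h * G (y (real n * h)) i s\<bar> \<le> h * (L * E)"
    using h by (metis abs_mult abs_of_nonneg mult_left_mono right_diff_distrib)
  have 2: "\<bar>y (real n * h + h) i s - (y (real n * h) i s + h * G (y (real n * h)) i s)\<bar> \<le> h * (L * (h * B))"
    using solution_local_error[OF y, of "real n * h" h i s] h nh by simp
  have 3: "\<bar>\<delta> * lattice_step h \<delta> k' i s - (\<delta> * k' i s + h * G (grid \<delta> k') i s)\<bar>
    \<le> h * (L * (h * B + \<delta>)) + \<delta>"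
    by (rule lattice_step_error[OF \<delta> h])
  have "\<bar>\<delta> * lattice_step h \<delta> k' i s - y (real n * h + h) i s\<bar> \<le> E + h * (L * E) + e"
    using 1 2 3 IH[of i s] unfolding e_def by linarith
  also have "\<dots> = real n * (1 + h * L) ^ Suc n * e + e" by (simp add: E_def algebra_simps)
  also have "\<dots> \<le> real n * (1 + h * L) ^ Suc n * e + (1 + h * L) ^ Suc n * e"
  proof -
    have "1 \<le> (1 + h * L) ^ Suc n" using h L_nonneg by (intro one_le_power) simp
    then show ?thesis using e by (simp add: mult_le_cancel_right1 del: power_Suc)
  qed
  also have "\<dots> = real (Suc n) * (1 + h * L) ^ Suc n * e"
    by (simp add: algebra_simps)
  finally show ?case by (simp add: k'_def e_def algebra_simps)
qed

lemma lattice_approximation: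
  assumes "0 < T" "0 < \<eta>"
  obtains \<delta> P where "0 < \<delta>" "\<delta> < \<eta>" "inj P"
    "\<And>k i s. (\<And>y. G y i s = 0) \<Longrightarrow> P k i s = k i s"
    "\<And>y k i s. solution T y \<Longrightarrow> y 0 = grid \<delta> k \<Longrightarrow> \<bar>grid \<delta> (P k) i s - y T i s\<bar> \<le> \<eta>"
proof -
  \<comment> \<open>For \<open>h < 1\<close> and \<open>\<delta> = h * h\<close> the local error is
    at most \<open>h * h * c\<close>. Summed over \<open>T / h\<close> steps and amplified by at
    most \<open>exp (L * T)\<close>, it is at most \<open>h * w\<close>.\<close>
  define c where "c = 2 * L * B + L + 1"
  have c: "1 \<le> c" using B_nonneg L_nonneg by (simp add: c_def)
  define w where "w = T * exp (L * T) * c + 1"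
  have w: "1 \<le> w" using assms c by (simp add: w_def)
  \<comment> \<open>A bound for the step size. The summand 1 in \<open>w\<close> gives
    \<open>\<eta> / w \<le> \<eta>\<close>; halving makes the inequalities strict.\<close>
  define m where "m = min 1 (\<eta> / w) / 2"
  have m: "0 < m" "m < 1" "m * w \<le> \<eta>" "m < \<eta>"
  proof -
    show "0 < m" "m < 1" using assms w by (auto simp: m_def)
    define v where "v = \<eta> / w"
    have "0 < v" using assms w by (simp add: v_def)
    then have "m \<le> v" "m < v" unfolding m_def v_def[symmetric] by linarith+
    then have "m \<le> \<eta> / w" "m < \<eta> / w" by (simp_all add: v_def)
    moreover have "\<eta> / w \<le> \<eta>" using assms w by (simp add: divide_le_eq mult_le_cancel_left1)
    ultimately show "m < \<eta>" by linarith
    show "m * w \<le> \<eta>" using \<open>m \<le> \<eta> / w\<close> w by (simp add: field_simps)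
  qed
  obtain n where n: "T / m < real n" using reals_Archimedean2 by blast
  have npos: "0 < real n" using n m assms by (smt (verit) divide_pos_pos)
  define h where "h = T / real n"
  \<comment> \<open>The mesh is quadratic in the step size: rounding contributes
    \<open>\<delta>\<close> in each of \<open>T / h\<close> steps, hence only order \<open>h\<close>
    in total.\<close>
  define \<delta> where "\<delta> = h * h"
  have nh: "real n * h = T" using npos by (simp add: h_def)
  have h: "0 < h" "h < m" using n npos m assms by (auto simp: h_def field_simps)
  have \<delta>: "0 < \<delta>" "\<delta> < \<eta>" 
  proof -
    show "0 < \<delta>" using h by (simp add: \<delta>_def)
    have "\<delta> \<le> h * 1" unfolding \<delta>_def using h m by (intro mult_left_mono) auto
    then show "\<delta> < \<eta>" using h m by simp
  qed
  have err: "\<bar>grid \<delta> ((lattice_step h \<delta> ^^ n) k) i s - y T i s\<bar> \<le> \<eta>"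
    if y: "solution T y" "y 0 = grid \<delta> k" for y k i s
  proof -
    have "(1 + h * L) ^ n \<le> exp (h * L) ^ n"
      using h L_nonneg by (intro power_mono) (auto intro: exp_ge_add_one_self)
    also have "\<dots> = exp (real n * h * L)" by (simp add: exp_of_nat_mult[symmetric] mult.assoc)
    also have "\<dots> = exp (L * T)" by (subst nh) (simp add: mult.commute)
    finally have pow: "(1 + h * L) ^ n \<le> exp (L * T)" .
    have "h * (L * (h * B)) + h * (L * (h * B + \<delta>)) + \<delta> = h * h * (2 * L * B + h * L + 1)"
      by (simp add: \<delta>_def algebra_simps)
    also have "\<dots> \<le> h * h * c"
      unfolding c_def using h m L_nonneg by (intro mult_left_mono add_mono) (auto simp: mult_left_le_one_le)
    finally have loc: "h * (L * (h * B)) + h * (L * (h * B + \<delta>)) + \<delta> \<le> h * h * c" .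
    have "\<bar>\<delta> * (lattice_step h \<delta> ^^ n) k i s - y T i s\<bar>
      \<le> real n * (1 + h * L) ^ n * (h * (L * (h * B)) + h * (L * (h * B + \<delta>)) + \<delta>)"
      using lattice_steps_error[OF y \<delta>(1), of h n i s] h nh by simp
    also have "\<dots> \<le> real n * exp (L * T) * (h * h * c)"
      using pow loc h \<delta> B_nonneg L_nonneg by (intro mult_mono) auto
    also have "\<dots> = h * ((real n * h) * exp (L * T) * c)" by (simp add: algebra_simps)
    also have "\<dots> \<le> m * w"
      unfolding nh w_def using h assms c by (intro mult_mono) auto
    finally show ?thesis using m by (simp add: grid_def)
  qed
  have fixed: "(lattice_step h \<delta> ^^ n) k i s = k i s" if "\<And>y. G y i s = 0" for k i s
    by (induction n) (auto simp: lattice_step_fixed[OF that])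
  have "inj (lattice_step h \<delta> ^^ n)" using inj_fn inj_lattice_step by blast
  with that \<delta> fixed err show thesis by blast
qed

end

section \<open>Unbounded drift of an injective lattice map\<close>

lemma lattice_drift_unbounded:
  fixes P :: "('i::finite \<Rightarrow> 's::finite \<Rightarrow> int) \<Rightarrow> 'i \<Rightarrow> 's \<Rightarrow> int"
  assumes inj: "inj P"
    and inv: "\<And>k i s. (i, s) \<notin> I \<Longrightarrow> P k i s = k i s"
    and I: "I \<noteq> {}" and k0: "\<And>i s. (i, s) \<notin> I \<Longrightarrow> k\<^sub>0 i s = 0"
  defines "drift \<equiv> \<lambda>k l. (\<forall>i s. \<bar>l i s - P k i s\<bar> \<le> 1) \<and> (\<forall>i s. (i, s) \<notin> I \<longrightarrow> l i s = 0)"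
  obtains k i s where "drift\<^sup>*\<^sup>* k\<^sub>0 k" "(i, s) \<in> I" "M < \<bar>k i s\<bar>"
proof -
  define R where "R = {k. drift\<^sup>*\<^sup>* k\<^sub>0 k}"
  have supp: "k i s = 0" if "k \<in> R" "(i, s) \<notin> I" for k i s
  proof -
    from that(1) have "drift\<^sup>*\<^sup>* k\<^sub>0 k" by (simp add: R_def)
    then show ?thesis by (cases rule: rtranclp.cases) (use that(2) k0 in \<open>auto simp: drift_def\<close>)
  qed
  have "infinite R"
  proof
    assume fin: "finite R"
    have drift: "l \<in> R" if "k \<in> R" "drift k l" for k l
      using that unfolding R_def by (auto intro: rtranclp.rtrancl_into_rtrancl)
    have "P ` R \<subseteq> R"
    proof
      fix l assume "l \<in> P ` R"
      then obtain k where "k \<in> R" "l = P k" by auto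
      moreover have "drift k (P k)"
        using supp[OF \<open>k \<in> R\<close>] by (simp add: drift_def inv)
      ultimately show "l \<in> R" using drift by simp
    qed
    \<comment> \<open>An injective self-map of a finite set is onto. So each reachable
      \<open>k\<close> is \<open>P l\<close> with \<open>l\<close> reachable, and the neighbours of
      \<open>k\<close> that vanish outside \<open>I\<close> are reachable from \<open>l\<close> as
      well.\<close>
    then have onto: "P ` R = R"
      using fin inj by (intro endo_inj_surj) (auto intro: inj_on_subset)
    obtain i s where coord: "(i, s) \<in> I" using I by auto
    \<comment> \<open>Raising one free coordinate by one is an error that \<open>drift\<close>
      tolerates; iterating it produces infinitely many reachable points.\<close>
    define up where "up k = k(i := (k i)(s := k i s + 1))" for k :: "'i \<Rightarrow> 's \<Rightarrow> int"
    have "up k \<in> R" if k: "k \<in> R" for k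
    proof -
      from k onto obtain l where "l \<in> R" "k = P l" by blast
      moreover have "drift l (up k)"
        unfolding drift_def \<open>k = P l\<close>[symmetric] using supp[OF k] coord
        by (simp add: up_def)
      ultimately show ?thesis using drift by simp
    qed
    moreover have "k\<^sub>0 \<in> R" by (simp add: R_def)
    ultimately have mem: "(up ^^ n) k\<^sub>0 \<in> R" for n by (induction n) auto
    have "(up ^^ n) k\<^sub>0 i s = k\<^sub>0 i s + int n" for n by (induction n) (simp_all add: up_def)
    then have "inj (\<lambda>n. (up ^^ n) k\<^sub>0)" by (intro injI) (metis add_left_cancel of_nat_eq_iff)
    moreover have "range (\<lambda>n. (up ^^ n) k\<^sub>0) \<subseteq> R" using mem by auto
    ultimately show False using fin by (metis finite_subset range_inj_infinite)
  qed
  \<comment> \<open>Using \<open>\<bar>M\<bar>\<close> keeps 0 inside the box even for negative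
    \<open>M\<close>, so a coordinate that leaves the box is nonzero and therefore belongs to
    \<open>I\<close>.\<close>
  moreover have "finite {k :: 'i \<Rightarrow> 's \<Rightarrow> int. \<forall>i s. k i s \<in> {-\<bar>M\<bar>..\<bar>M\<bar>}}"
  proof -
    have "finite (Pi\<^sub>E (UNIV :: 'i set) (\<lambda>_. Pi\<^sub>E (UNIV :: 's set) (\<lambda>_. {-\<bar>M\<bar>..\<bar>M\<bar>})))"
      by (intro finite_PiE) auto
    moreover have "{k :: 'i \<Rightarrow> 's \<Rightarrow> int. \<forall>i s. k i s \<in> {-\<bar>M\<bar>..\<bar>M\<bar>}}
        = Pi\<^sub>E (UNIV :: 'i set) (\<lambda>_. Pi\<^sub>E (UNIV :: 's set) (\<lambda>_. {-\<bar>M\<bar>..\<bar>M\<bar>}))"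
      by (rule set_eqI) (simp only: PiE_iff mem_Collect_eq extensional_UNIV UNIV_I simp_thms ball_UNIV)
    ultimately show ?thesis by simp
  qed
  ultimately have "\<not> R \<subseteq> {k. \<forall>i s. k i s \<in> {-\<bar>M\<bar>..\<bar>M\<bar>}}" using finite_subset by blast
  then obtain k i s where k: "k \<in> R" and *: "k i s \<notin> {-\<bar>M\<bar>..\<bar>M\<bar>}" by blast
  have "(i, s) \<in> I"
  proof (rule ccontr)
    assume "(i, s) \<notin> I"
    from supp[OF k this] * show False by simp
  qed
  moreover have "M < \<bar>k i s\<bar>" using * by auto
  ultimately show thesis using that[of k i s] k by (simp add: R_def)
qed

section \<open>Logarithmic coordinates\<close>

lemma mixed_profiles_nth_bounds:
  assumes "x \<in> mixed_profiles S"
  shows "0 \<le> x $ i $ s" "x $ i $ s \<le> 1"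
proof -
  have 1: "\<forall>s\<in>S i. 0 \<le> x $ i $ s" "\<forall>s. s \<notin> S i \<longrightarrow> x $ i $ s = 0" "(\<Sum>s\<in>S i. x $ i $ s) = 1"
    using assms by (auto simp: mixed_profiles_def)
  then show "0 \<le> x $ i $ s" by (cases "s \<in> S i") auto
  show "x $ i $ s \<le> 1"
  proof (cases "s \<in> S i")
    case True
    then have "x $ i $ s \<le> (\<Sum>s\<in>S i. x $ i $ s)" using 1 by (intro member_le_sum) auto
    then show ?thesis using 1 by simp
  qed (use 1 in auto)
qed

lemma dist_le_entries:
  fixes x y :: "real ^ 's::finite ^ 'i::finite"
  assumes "\<And>i s. \<bar>x $ i $ s - y $ i $ s\<bar> \<le> r"
  shows "dist x y \<le> real (CARD('i) * CARD('s)) * r"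
proof -
  have "norm ((x - y) $ i) \<le> real CARD('s) * r" for i
  proof -
    have "norm ((x - y) $ i) \<le> (\<Sum>s\<in>UNIV. \<bar>(x - y) $ i $ s\<bar>)" by (rule norm_le_l1_cart)
    also have "\<dots> \<le> (\<Sum>s\<in>(UNIV::'s set). r)" using assms by (intro sum_mono) simp
    finally show ?thesis by simp
  qed
  note row = this
  have "dist x y = L2_set (\<lambda>i. norm ((x - y) $ i)) UNIV" by (simp add: dist_norm norm_vec_def)
  also have "\<dots> \<le> (\<Sum>i\<in>UNIV. norm ((x - y) $ i))" by (rule L2_set_le_sum) simp
  also have "\<dots> \<le> (\<Sum>i\<in>(UNIV::'i set). real CARD('s) * r)" by (intro sum_mono row)
  finally show ?thesis by simp
qed

section \<open>Bounds and Lipschitz estimates for payoffs\<close>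

definition utility_bound ::
  "('i::finite \<Rightarrow> 's::finite set) \<Rightarrow> (('i \<Rightarrow> 's) \<Rightarrow> real ^ 'i) \<Rightarrow> real" where
  "utility_bound S u = (\<Sum>q\<in>pure_profiles S. \<Sum>i\<in>UNIV. \<bar>u q $ i\<bar>)"

lemma utility_bound_nonneg: "0 \<le> utility_bound S u"
  by (simp add: utility_bound_def sum_nonneg)

lemma sum_profile_utilities_le:
  assumes "\<And>q. \<bar>f q\<bar> \<le> r" "0 \<le> r"
  shows "\<bar>\<Sum>q\<in>pure_profiles S. f q * u q $ p\<bar> \<le> r * utility_bound S u"
proof -
  have "\<bar>\<Sum>q\<in>pure_profiles S. f q * u q $ p\<bar> \<le> (\<Sum>q\<in>pure_profiles S. \<bar>f q\<bar> * \<bar>u q $ p\<bar>)"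
    by (rule order_trans[OF sum_abs]) (simp add: abs_mult)
  also have "\<dots> \<le> (\<Sum>q\<in>pure_profiles S. r * (\<Sum>i\<in>UNIV. \<bar>u q $ i\<bar>))"
    using assms by (intro sum_mono mult_mono member_le_sum) auto
  finally show ?thesis by (simp add: utility_bound_def sum_distrib_left)
qed

lemma strategy_utility_eq:
  "strategy_utility S u p s x =
    (\<Sum>q\<in>pure_profiles S. (\<Prod>i\<in>UNIV. if i = p then axis s 1 $ q i else x $ i $ q i) * u q $ p)"
  unfolding strategy_utility_def expected_utility_def
  by (simp add: if_distrib[of "\<lambda>v. v $ _"] cong: if_cong)

text \<open>The mixture of player \<open>p\<close> is overwritten by \<open>s\<close> before payoffs
  are computed. This is the source of the shear structure.\<close>

lemma strategy_utility_cong: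
  "(\<And>j. j \<noteq> p \<Longrightarrow> x $ j = y $ j) \<Longrightarrow> strategy_utility S u p s x = strategy_utility S u p s y"
  unfolding strategy_utility_eq by (intro sum.cong arg_cong2[where f = "(*)"] prod.cong) auto

lemma strategy_utility_bounded:
  assumes "x \<in> mixed_profiles S"
  shows "\<bar>strategy_utility S u p s x\<bar> \<le> utility_bound S u"
proof -
  have "\<bar>\<Prod>i\<in>UNIV. if i = p then axis s 1 $ q i else x $ i $ q i\<bar> \<le> 1" for q
    unfolding abs_prod using mixed_profiles_nth_bounds[OF assms] by (intro prod_le_1) (auto simp: axis_def)
  from sum_profile_utilities_le[where S = S and u = u and p = p, OF this] show ?thesis by (simp add: strategy_utility_eq)
qed

text \<open>Products of factors in the unit interval differ by at most the sum of the differences of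
  their factors, one for each player.\<close>

lemma strategy_utility_lipschitz:
  fixes x y :: "real ^ 's::finite ^ 'i::finite" and r :: real
  assumes "x \<in> mixed_profiles S" "y \<in> mixed_profiles S" "\<And>i s. \<bar>x $ i $ s - y $ i $ s\<bar> \<le> r"
  shows "\<bar>strategy_utility S u p s x - strategy_utility S u p s y\<bar> \<le> CARD('i) * r * utility_bound S u"
proof -
  let ?P = "\<lambda>x q. \<Prod>i\<in>UNIV. if i = p then axis s 1 $ q i else x $ i $ q i"
  have r: "0 \<le> r" using assms(3) by (meson abs_ge_zero order_trans)
  have "\<bar>?P x q - ?P y q\<bar> \<le> CARD('i) * r" for q
  proof -
    have "norm (?P x q - ?P y q) \<le> (\<Sum>i\<in>UNIV. norm ((if i = p then axis s 1 $ q i else x $ i $ q i)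
      - (if i = p then axis s 1 $ q i else y $ i $ q i)))"
      using mixed_profiles_nth_bounds[OF assms(1)] mixed_profiles_nth_bounds[OF assms(2)]
      by (intro norm_prod_diff) (auto simp: axis_def)
    also have "\<dots> \<le> (\<Sum>i\<in>(UNIV::'i set). r)" using assms(3) r by (intro sum_mono) auto
    finally show ?thesis by simp
  qed
  then have "\<bar>\<Sum>q\<in>pure_profiles S. (?P x q - ?P y q) * u q $ p\<bar> \<le> (CARD('i) * r) * utility_bound S u"
    using r by (intro sum_profile_utilities_le) auto
  then show ?thesis unfolding strategy_utility_eq by (simp add: sum_subtractf left_diff_distrib)
qed

section \<open>Softmax as a chart of the relative interior of a face\<close>

definition softmax ::
  "('i::finite \<Rightarrow> 's::finite set) \<Rightarrow> ('i \<Rightarrow> 's \<Rightarrow> real) \<Rightarrow> real ^ 's ^ 'i" where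
  "softmax A y = (\<chi> i s. if s \<in> A i then exp (y i s) / (\<Sum>t\<in>A i. exp (y i t)) else 0)"

lemma softmax_pos: "s \<in> A i \<Longrightarrow> 0 < softmax A y $ i $ s"
  by (auto simp: softmax_def intro!: divide_pos_pos sum_pos)

lemma softmax_outside: "s \<notin> A i \<Longrightarrow> softmax A y $ i $ s = 0"
  by (simp add: softmax_def)

lemma softmax_mixed_profiles:
  assumes "\<And>i. A i \<noteq> {}" "\<And>i. A i \<subseteq> S i"
  shows "softmax A y \<in> mixed_profiles S"
proof -
  have "(\<Sum>s\<in>S i. softmax A y $ i $ s) = 1" for i
  proof -
    have "0 < (\<Sum>t\<in>A i. exp (y i t))" using assms(1) by (intro sum_pos) auto
    moreover have "(\<Sum>s\<in>S i. softmax A y $ i $ s) = (\<Sum>s\<in>A i. exp (y i s) / (\<Sum>t\<in>A i. exp (y i t)))"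
      using assms(2) by (intro sum.mono_neutral_cong_right) (auto simp: softmax_def)
    ultimately show ?thesis by (simp flip: sum_divide_distrib)
  qed
  moreover have "0 \<le> softmax A y $ i $ s" for i s
    using softmax_pos[of s A i y] softmax_outside[of s A i y] by (cases "s \<in> A i") auto
  moreover have "softmax A y $ i $ s = 0" if "s \<notin> S i" for i s
    using that assms(2) by (intro softmax_outside) auto
  ultimately show ?thesis by (simp add: mixed_profiles_def)
qed

text \<open>The numerator and the normalising sum each change by a factor of at most
  \<open>exp r\<close>.\<close>

lemma softmax_ratio:
  assumes "\<And>i s. \<bar>y i s - z i s\<bar> \<le> r"
  shows "softmax A y $ i $ s \<le> exp (2 * r) * softmax A z $ i $ s"
proof (cases "s \<in> A i")
  case True
  have ineq: "exp (y i t) \<le> exp r * exp (z i t)" "exp (z i t) \<le> exp r * exp (y i t)" for t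
    using assms[of i t] by (auto simp flip: exp_add)
  define Y where "Y = (\<Sum>t\<in>A i. exp (y i t))"
  define Z where "Z = (\<Sum>t\<in>A i. exp (z i t))"
  have pos: "0 < Y" "0 < Z" unfolding Y_def Z_def using True by (auto intro!: sum_pos)
  have "Z \<le> exp r * Y" unfolding Y_def Z_def sum_distrib_left by (intro sum_mono ineq)
  then have "exp (y i s) * Z \<le> (exp r * exp (z i s)) * (exp r * Y)"
    using ineq(1)[of s] pos by (intro mult_mono) auto
  also have "\<dots> = exp (2 * r) * exp (z i s) * Y" by (simp add: exp_double power2_eq_square)
  finally have "exp (y i s) / Y \<le> exp (2 * r) * (exp (z i s) / Z)"
    using pos by (simp add: field_simps)
  then show ?thesis using True by (simp add: softmax_def Y_def Z_def)
qed (simp add: softmax_outside)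

lemma softmax_lipschitz:
  assumes "\<And>i. A i \<noteq> {}" and close: "\<And>i s. \<bar>y i s - z i s\<bar> \<le> r"
  shows "\<bar>softmax A y $ i $ s - softmax A z $ i $ s\<bar> \<le> 4 * r"
proof -
  have bounds: "0 \<le> softmax A w $ i $ s" "softmax A w $ i $ s \<le> 1" for w
    using mixed_profiles_nth_bounds[OF softmax_mixed_profiles[where S = A]] assms by auto
  have r: "0 \<le> r" using close by (meson abs_ge_zero order_trans)
  show ?thesis
  \<comment> \<open>For small \<open>r\<close> the quadratic bound on \<open>exp\<close> turns the
    ratio estimate into a linear one. For large \<open>r\<close> the claim is trivial, as both
    values lie between 0 and 1.\<close>
  proof (cases "2 * r \<le> 1")
    case True
    have "exp (2 * r) \<le> 1 + 2 * r + (2 * r)\<^sup>2" using exp_bound[of "2 * r"] r True by simp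
    also have "(2 * r)\<^sup>2 \<le> 2 * r" using mult_left_le[of "2 * r" "2 * r"] r True by (simp add: power2_eq_square)
    finally have e: "exp (2 * r) - 1 \<le> 4 * r" by simp
    have "softmax A v $ i $ s - softmax A w $ i $ s \<le> 4 * r"
      if "softmax A v $ i $ s \<le> exp (2 * r) * softmax A w $ i $ s" for v w
    proof -
      have "softmax A v $ i $ s - softmax A w $ i $ s \<le> (exp (2 * r) - 1) * softmax A w $ i $ s"
        using that by (simp add: algebra_simps)
      also have "\<dots> \<le> (exp (2 * r) - 1) * 1" using bounds r by (intro mult_left_mono) auto
      finally show ?thesis using e by simp
    qed
    moreover have "\<bar>z i s - y i s\<bar> \<le> r" for i s using close[of i s] by (simp add: abs_minus_commute)
    ultimately show ?thesis using softmax_ratio close by (metis abs_le_iff minus_diff_eq)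
  next
    case False
    then show ?thesis using bounds[of y] bounds[of z] by linarith
  qed
qed

text \<open>The velocity of \<open>ln (x $ i $ s) - ln (x $ i $ a i)\<close>, written in these
  coordinates: the mean payoffs cancel. The value 0 outside \<open>A i\<close> freezes coordinates
  that do not belong to the face.\<close>

definition log_field ::
  "('i::finite \<Rightarrow> 's::finite set) \<Rightarrow> (('i \<Rightarrow> 's) \<Rightarrow> real ^ 'i) \<Rightarrow> ('i \<Rightarrow> 's set) \<Rightarrow> ('i \<Rightarrow> 's) \<Rightarrow>
    ('i \<Rightarrow> 's \<Rightarrow> real) \<Rightarrow> 'i \<Rightarrow> 's \<Rightarrow> real" where
  "log_field S u A a y i s = (if s \<in> A i
     then strategy_utility S u i s (softmax A y) - strategy_utility S u i (a i) (softmax A y) else 0)"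

text \<open>The field is a difference of two payoffs, whence the factor 2. The factor 8 of the
  Lipschitz constant combines this 2 with the constant 4 of
  \<open>softmax_lipschitz\<close>.\<close>

lemma shear_field_log_field:
  fixes S :: "'i::finite \<Rightarrow> 's::finite set"
  assumes "\<And>i. A i \<noteq> {}" "\<And>i. A i \<subseteq> S i"
  shows "shear_field (log_field S u A a) (2 * utility_bound S u) (8 * CARD('i) * utility_bound S u)"
proof
  fix y z :: "'i \<Rightarrow> 's \<Rightarrow> real" and i s r
  note mixed = softmax_mixed_profiles[of A S, OF assms]
  note bound = strategy_utility_bounded[OF mixed]
  show "log_field S u A a y i = log_field S u A a z i" if "\<And>j. j \<noteq> i \<Longrightarrow> y j = z j"
  proof -
    have "softmax A y $ j = softmax A z $ j" if "j \<noteq> i" for j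
      using \<open>\<And>j. j \<noteq> i \<Longrightarrow> y j = z j\<close> that by (simp add: softmax_def cong: if_cong)
    then have "strategy_utility S u i s (softmax A y) = strategy_utility S u i s (softmax A z)" for s
      by (rule strategy_utility_cong)
    then show ?thesis by (auto simp: log_field_def)
  qed
  show "\<bar>log_field S u A a y i s\<bar> \<le> 2 * utility_bound S u"
    using bound[of u i s y] bound[of u i "a i" y] utility_bound_nonneg[of S u]
    unfolding log_field_def by (smt (verit))
  show "\<bar>log_field S u A a y i s - log_field S u A a z i s\<bar> \<le> 8 * CARD('i) * utility_bound S u * r"
    if close: "\<And>j t. \<bar>y j t - z j t\<bar> \<le> r"
  proof -
    have r: "0 \<le> r" using close by (meson abs_ge_zero order_trans)
    have lip: "\<bar>strategy_utility S u i s (softmax A y) - strategy_utility S u i s (softmax A z)\<bar>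
      \<le> CARD('i) * (4 * r) * utility_bound S u" for s
      using assms close by (intro strategy_utility_lipschitz mixed softmax_lipschitz)
    have "8 * CARD('i) * utility_bound S u * r = 2 * (CARD('i) * (4 * r) * utility_bound S u)" by simp
    then show ?thesis using lip[of s] lip[of "a i"] unfolding log_field_def by (smt (verit))
  qed
qed (simp_all add: utility_bound_nonneg)

section \<open>The replicator flow on the faces of the strategy space\<close>

lemma replicator_flowD:
  assumes "replicator_flow S u \<phi>" "x \<in> mixed_profiles S"
  shows "\<phi> x 0 = x" "\<phi> x (s + t) = \<phi> (\<phi> x s) t" "\<phi> x t \<in> mixed_profiles S"
    "(\<phi> x has_vector_derivative replicator_field S u (\<phi> x t)) (at t)"
  using assms unfolding replicator_flow_def by blast+

text \<open>The logarithmic derivative of \<open>x $ i $ s\<close> along the flow wherever that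
  entry is positive.\<close>

definition growth_rate ::
  "('i::finite \<Rightarrow> 's::finite set) \<Rightarrow> (('i \<Rightarrow> 's) \<Rightarrow> real ^ 'i) \<Rightarrow> 'i \<Rightarrow> 's \<Rightarrow> real ^ 's ^ 'i \<Rightarrow> real" where
  "growth_rate S u i s x =
    strategy_utility S u i s x - (\<Sum>t\<in>S i. x $ i $ t * strategy_utility S u i t x)"

lemma replicator_flow_derivative:
  assumes "replicator_flow S u \<phi>" "x \<in> mixed_profiles S"
  shows "((\<lambda>t. \<phi> x t $ i $ s) has_real_derivative
    \<phi> x t $ i $ s * growth_rate S u i s (\<phi> x t)) (at t)"
proof -
  have "((\<lambda>t. \<phi> x t $ i $ s) has_vector_derivative replicator_field S u (\<phi> x t) $ i $ s) (at t)"
    by (intro bounded_linear.has_vector_derivative[OF bounded_linear_vec_nth]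
        replicator_flowD(4)[OF assms])
  then show ?thesis
    by (simp add: has_real_derivative_iff_has_vector_derivative replicator_field_def growth_rate_def)
qed

lemma growth_rate_bounded:
  assumes "x \<in> mixed_profiles S"
  shows "\<bar>growth_rate S u i s x\<bar> \<le> 2 * utility_bound S u"
proof -
  note U = strategy_utility_bounded[OF assms, of u i]
  have sum1: "(\<Sum>t\<in>S i. x $ i $ t) = 1" using assms by (simp add: mixed_profiles_def)
  have "\<bar>\<Sum>t\<in>S i. x $ i $ t * strategy_utility S u i t x\<bar> \<le> (\<Sum>t\<in>S i. x $ i $ t * utility_bound S u)"
    using mixed_profiles_nth_bounds[OF assms] U
    by (intro order_trans[OF sum_abs] sum_mono) (simp add: abs_mult mult_left_mono)
  also have "\<dots> = utility_bound S u" using sum1 by (simp flip: sum_distrib_right)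
  finally show ?thesis using U[of s] by (simp add: growth_rate_def)
qed

text \<open>If \<open>c\<close> bounds the absolute growth rate, then \<open>x\<^sub>s exp (c t)\<close> is nondecreasing and
  \<open>x\<^sub>s exp (- c t)\<close> nonincreasing in \<open>t\<close>.\<close>

lemma replicator_flow_support:
  assumes flow: "replicator_flow S u \<phi>" and x: "x \<in> mixed_profiles S" and "0 \<le> T"
  shows "0 < \<phi> x T $ i $ s \<longleftrightarrow> 0 < x $ i $ s"
proof -
  define c where "c = 2 * utility_bound S u"
  let ?x = "\<lambda>t. \<phi> x t $ i $ s"
  note X = replicator_flowD(3)[OF flow x]
  have rate: "\<bar>growth_rate S u i s (\<phi> x t)\<bar> \<le> c" for t
    unfolding c_def by (intro growth_rate_bounded X)
  have nonneg: "0 \<le> ?x t" for t using X by (rule mixed_profiles_nth_bounds)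
  have der: "((\<lambda>t. ?x t * exp (b * t)) has_real_derivative
     ?x t * exp (b * t) * (growth_rate S u i s (\<phi> x t) + b)) (at t)" for b t
    by (rule derivative_eq_intros refl replicator_flow_derivative[OF flow x])+
      (simp add: algebra_simps)
  have "?x 0 * exp (c * 0) \<le> ?x T * exp (c * T)"
  proof (rule DERIV_nonneg_imp_nondecreasing[OF \<open>0 \<le> T\<close>])
    show "\<exists>y. ((\<lambda>t. ?x t * exp (c * t)) has_real_derivative y) (at t) \<and> 0 \<le> y" for t
    proof -
      have "0 \<le> ?x t * exp (c * t) * (growth_rate S u i s (\<phi> x t) + c)"
        using rate[of t] nonneg[of t] by simp
      then show ?thesis using der[of c t] by blast
    qed
  qed
  moreover have "?x T * exp (- c * T) \<le> ?x 0 * exp (- c * 0)"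
  proof (rule DERIV_nonpos_imp_nonincreasing[OF \<open>0 \<le> T\<close>])
    show "\<exists>y. ((\<lambda>t. ?x t * exp (- c * t)) has_real_derivative y) (at t) \<and> y \<le> 0" for t
    proof -
      have "?x t * exp (- c * t) * (growth_rate S u i s (\<phi> x t) + - c) \<le> 0"
        using rate[of t] nonneg[of t] by (intro mult_nonneg_nonpos) auto
      then show ?thesis using der[of "- c" t] by blast
    qed
  qed
  ultimately have "?x 0 \<le> ?x T * exp (c * T)" "?x T * exp (- c * T) \<le> ?x 0" by simp_all
  moreover have "?x 0 = x $ i $ s" using replicator_flowD(1)[OF flow x] by simp
  moreover have "0 < ?x T * exp (c * T) \<longleftrightarrow> 0 < ?x T" "0 < ?x T * exp (- c * T) \<longleftrightarrow> 0 < ?x T"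
    by (simp_all only: zero_less_mult_iff) auto
  ultimately show ?thesis by linarith
qed

section \<open>Relative interiors of faces and the flow in their logarithmic coordinates\<close>

definition open_face :: "('i::finite \<Rightarrow> 's::finite set) \<Rightarrow> ('i \<Rightarrow> 's set) \<Rightarrow> (real ^ 's ^ 'i) set" where
  "open_face S A = {x \<in> mixed_profiles S. \<forall>i s. 0 < x $ i $ s \<longleftrightarrow> s \<in> A i}"

lemma open_face_outside:
  assumes "x \<in> open_face S A" "s \<notin> A i"
  shows "x $ i $ s = 0"
proof -
  have "x \<in> mixed_profiles S" "\<not> 0 < x $ i $ s" using assms by (auto simp: open_face_def)
  then show ?thesis using mixed_profiles_nth_bounds(1)[of x S i s] by simp
qed

lemma open_face_sum:
  assumes "x \<in> open_face S A" "A i \<subseteq> S i"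
  shows "(\<Sum>s\<in>A i. x $ i $ s) = 1"
proof -
  have "(\<Sum>s\<in>A i. x $ i $ s) = (\<Sum>s\<in>S i. x $ i $ s)"
    using assms open_face_outside by (intro sum.mono_neutral_left) auto
  then show ?thesis using assms(1) by (simp add: open_face_def mixed_profiles_def)
qed

lemma open_face_support:
  assumes "x \<in> open_face S A"
  shows "A i \<noteq> {}" "A i \<subseteq> S i"
proof -
  have x: "x \<in> mixed_profiles S" and pos: "\<And>i s. 0 < x $ i $ s \<longleftrightarrow> s \<in> A i"
    using assms by (auto simp: open_face_def)
  show sub: "A i \<subseteq> S i"
  proof
    fix s assume "s \<in> A i"
    then have "x $ i $ s \<noteq> 0" using pos[of i s] by simp
    then show "s \<in> S i" using x unfolding mixed_profiles_def by blast
  qed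
  show "A i \<noteq> {}" using open_face_sum[OF assms sub] by auto
qed

lemma softmax_open_face:
  assumes "\<And>i. A i \<noteq> {}" "\<And>i. A i \<subseteq> S i"
  shows "softmax A y \<in> open_face S A"
proof -
  have "0 < softmax A y $ i $ s \<longleftrightarrow> s \<in> A i" for i s
    using softmax_pos[of s A i y] softmax_outside[of s A i y] by (cases "s \<in> A i") auto
  then show ?thesis using softmax_mixed_profiles[OF assms] by (simp add: open_face_def)
qed

lemma replicator_flow_open_face:
  assumes "replicator_flow S u \<phi>" "x \<in> open_face S A" "0 \<le> t"
  shows "\<phi> x t \<in> open_face S A"
  using assms replicator_flow_support[OF assms(1) _ assms(3)] replicator_flowD(3)[OF assms(1)]
  unfolding open_face_def by blast

text \<open>Softmax does not change when a constant is added to all coordinates of one player;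
  subtracting the logarithm at \<open>a i\<close> singles out the preimage that vanishes
  there.\<close>

definition log_coords ::
  "('i::finite \<Rightarrow> 's::finite set) \<Rightarrow> ('i \<Rightarrow> 's) \<Rightarrow> real ^ 's ^ 'i \<Rightarrow> 'i \<Rightarrow> 's \<Rightarrow> real" where
  "log_coords A a x i s = (if s \<in> A i then ln (x $ i $ s) - ln (x $ i $ a i) else 0)"

lemma softmax_log_coords:
  assumes x: "x \<in> open_face S A" and a: "\<And>i. a i \<in> A i"
  shows "softmax A (log_coords A a x) = x"
proof -
  have "softmax A (log_coords A a x) $ i $ s = x $ i $ s" for i s
  proof (cases "s \<in> A i")
    case True
    have pos: "0 < x $ i $ t" if "t \<in> A i" for t using x that by (simp add: open_face_def)
    have e: "exp (log_coords A a x i t) = x $ i $ t / x $ i $ a i" if "t \<in> A i" for t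
      using that pos a by (simp add: log_coords_def exp_diff)
    have "(\<Sum>t\<in>A i. exp (log_coords A a x i t)) = 1 / x $ i $ a i"
      using open_face_sum[OF x open_face_support(2)[OF x]] by (simp add: e flip: sum_divide_distrib)
    then show ?thesis using True e[OF True] pos[OF a[of i]] by (simp add: softmax_def)
  next
    case False
    then show ?thesis using open_face_outside[OF x] by (simp add: softmax_outside)
  qed
  then show ?thesis by (simp add: vec_eq_iff)
qed

lemma log_coords_softmax:
  assumes "\<And>i. a i \<in> A i" "\<And>i. y i (a i) = 0" "\<And>i s. s \<notin> A i \<Longrightarrow> y i s = 0"
  shows "log_coords A a (softmax A y) = y"
proof (intro ext)
  fix i s
  have Z: "0 < (\<Sum>t\<in>A i. exp (y i t))" using assms(1)[of i] by (intro sum_pos) auto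
  show "log_coords A a (softmax A y) i s = y i s"
    using assms Z by (simp add: log_coords_def softmax_def ln_div)
qed

text \<open>The mean payoff of the player enters both growth rates and cancels in their difference.
  Forward invariance of the open face keeps the arguments of the logarithms positive.\<close>

lemma log_coords_solution:
  assumes flow: "replicator_flow S u \<phi>" and x: "x \<in> open_face S A" and a: "\<And>i. a i \<in> A i"
  shows "shear_field.solution (log_field S u A a) T (\<lambda>t. log_coords A a (\<phi> x t))"
proof -
  note sub = open_face_support[OF x]
  interpret shear_field "log_field S u A a" "2 * utility_bound S u" "8 * CARD('a) * utility_bound S u"
    using sub by (rule shear_field_log_field)
  have X: "x \<in> mixed_profiles S" using x by (simp add: open_face_def)
  show ?thesis unfolding solution_def
  proof (intro allI impI)
    fix i s t assume t: "0 \<le> (t::real)"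
    have face: "\<phi> x t \<in> open_face S A" using replicator_flow_open_face[OF flow x t] .
    then have pos: "0 < \<phi> x t $ i $ s" if "s \<in> A i" for s using that by (simp add: open_face_def)
    have ln: "((\<lambda>t. ln (\<phi> x t $ i $ s)) has_real_derivative growth_rate S u i s (\<phi> x t)) (at t)"
      if "s \<in> A i" for s
      by (rule derivative_eq_intros refl replicator_flow_derivative[OF flow X] pos[OF that])+
        (use pos[OF that] in simp)
    show "((\<lambda>t. log_coords A a (\<phi> x t) i s) has_real_derivative
      log_field S u A a (log_coords A a (\<phi> x t)) i s) (at t)"
    proof (cases "s \<in> A i")
      case True
      have "((\<lambda>t. ln (\<phi> x t $ i $ s) - ln (\<phi> x t $ i $ a i)) has_real_derivative
        growth_rate S u i s (\<phi> x t) - growth_rate S u i (a i) (\<phi> x t)) (at t)"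
        by (intro DERIV_diff ln True a)
      then show ?thesis
        using True by (simp add: log_coords_def[abs_def] log_field_def growth_rate_def
          softmax_log_coords[OF face a, unfolded log_coords_def[abs_def]])
    next
      case False
      then show ?thesis by (simp add: log_coords_def log_field_def)
    qed
  qed
qed

text \<open>All flow times are exactly \<open>T\<close>: such chains can be reversed using the uniform continuity of
  the single map \<open>\<lambda>x. \<phi> x T\<close>.\<close>

definition time_step ::
  "'a::metric_space set \<Rightarrow> ('a \<Rightarrow> real \<Rightarrow> 'a) \<Rightarrow> real \<Rightarrow> real \<Rightarrow> 'a \<Rightarrow> 'a \<Rightarrow> bool" where
  "time_step X \<phi> \<epsilon> T x y \<longleftrightarrow> x \<in> X \<and> y \<in> X \<and> dist (\<phi> x T) y < \<epsilon>"

lemma tranclp_mono_pred: "r\<^sup>+\<^sup>+ x y \<Longrightarrow> (\<And>a b. r a b \<Longrightarrow> s a b) \<Longrightarrow> s\<^sup>+\<^sup>+ x y"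
  by (induction rule: tranclp.induct) (auto intro: tranclp.trancl_into_trancl)

text \<open>Only the target of the final jump changes, so the triangle inequality is needed there
  alone. This lets a chain inside a face end on its boundary.\<close>

lemma time_step_perturb_last:
  assumes "(time_step X \<phi> \<epsilon> T)\<^sup>+\<^sup>+ x y" "z \<in> X" "dist y z \<le> \<delta>" "0 \<le> \<delta>"
  shows "(time_step X \<phi> (\<epsilon> + \<delta>) T)\<^sup>+\<^sup>+ x z"
proof -
  have mono: "time_step X \<phi> \<epsilon> T a b \<Longrightarrow> time_step X \<phi> (\<epsilon> + \<delta>) T a b" for a b
    using assms(4) by (auto simp: time_step_def)
  have last: "time_step X \<phi> \<epsilon> T a y \<Longrightarrow> time_step X \<phi> (\<epsilon> + \<delta>) T a z" for a
    using assms(2,3) dist_triangle[of "\<phi> a T" z y] by (auto simp: time_step_def)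
  from assms(1) show ?thesis
  proof (cases rule: tranclp.cases)
    case r_into_trancl
    then show ?thesis using last by auto
  next
    case (trancl_into_trancl b)
    have "(time_step X \<phi> (\<epsilon> + \<delta>) T)\<^sup>+\<^sup>+ x b"
      using trancl_into_trancl(1) mono by (rule tranclp_mono_pred)
    then show ?thesis using last[OF trancl_into_trancl(2)] by (rule tranclp.trancl_into_trancl)
  qed
qed

section \<open>Chains between the content and the vertices\<close>

text \<open>The mass of \<open>s\<close> is transferred to \<open>t\<close>, which changes each
  entry by at most \<open>x $ i $ s\<close>.\<close>

lemma open_face_remove:
  fixes x :: "real ^ 's::finite ^ 'i::finite"
  assumes x: "x \<in> open_face S A" and "s \<in> A i" "t \<in> A i" "s \<noteq> t"
  obtains b where "b \<in> open_face S (A(i := A i - {s}))" "dist x b \<le> real (CARD('i) * CARD('s)) * x $ i $ s"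
proof
  define v where "v = x $ i $ s"
  define b :: "real ^ 's ^ 'i" where
    "b = (\<chi> j r. x $ j $ r + (if j = i \<and> r = t then v else 0) - (if j = i \<and> r = s then v else 0))"
  have b: "b $ j $ r = x $ j $ r + (if j = i \<and> r = t then v else 0) - (if j = i \<and> r = s then v else 0)" for j r
    by (simp add: b_def)
  have X: "x \<in> mixed_profiles S" and pos: "\<And>i s. 0 < x $ i $ s \<longleftrightarrow> s \<in> A i"
    using x by (auto simp: open_face_def)
  have v: "0 < v" using pos \<open>s \<in> A i\<close> by (simp add: v_def)
  have mem: "s \<in> S i" "t \<in> S i" using open_face_support(2)[OF x] assms by auto
  have nonneg: "0 \<le> b $ j $ r" for j r
    using mixed_profiles_nth_bounds(1)[OF X, of j r] v \<open>s \<noteq> t\<close> by (auto simp: b v_def)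
  have "(\<Sum>r\<in>S j. b $ j $ r) = 1" for j
  proof -
    have "(\<Sum>r\<in>S j. b $ j $ r) = (\<Sum>r\<in>S j. x $ j $ r)"
      using mem by (cases "j = i") (simp_all add: b sum.distrib sum_subtractf)
    then show ?thesis using X by (simp add: mixed_profiles_def)
  qed
  moreover have "b $ j $ r = 0" if "r \<notin> S j" for j r
    using that X mem by (auto simp: b mixed_profiles_def)
  ultimately have "b \<in> mixed_profiles S" using nonneg by (simp add: mixed_profiles_def)
  moreover have "0 < b $ j $ r \<longleftrightarrow> r \<in> (A(i := A i - {s})) j" for j r
    using pos[of j r] v assms by (auto simp: b v_def)
  ultimately show "b \<in> open_face S (A(i := A i - {s}))" by (simp add: open_face_def)
  have "\<bar>x $ j $ r - b $ j $ r\<bar> \<le> v" for j r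
    using v \<open>s \<noteq> t\<close> by (auto simp: b)
  from dist_le_entries[of x b, OF this]
  show "dist x b \<le> real (CARD('i) * CARD('s)) * x $ i $ s" by (simp add: v_def)
qed

text \<open>Only the term of \<open>t\<close> is kept in the normalising sum. A wide gap between two
  coordinates thus forces a tiny probability.\<close>

lemma softmax_le_exp_diff:
  assumes "t \<in> A i"
  shows "softmax A y $ i $ s \<le> exp (y i s - y i t)"
proof -
  have "exp (y i t) \<le> (\<Sum>t\<in>A i. exp (y i t))" using assms by (intro member_le_sum) auto
  then have "exp (y i s) / (\<Sum>t\<in>A i. exp (y i t)) \<le> exp (y i s) / exp (y i t)"
    by (intro divide_left_mono) (auto intro!: mult_pos_pos intro: less_le_trans[OF exp_gt_zero])
  then show ?thesis by (simp add: softmax_def exp_diff)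
qed

text \<open>Lattice drift in logarithmic coordinates is a pseudo-orbit in the open face. Once one
  coordinate is huge, some probability is so small that the last jump may set it to zero.\<close>

lemma chain_to_smaller_face:
  fixes x :: "real ^ 's::finite ^ 'i::finite"
  assumes flow: "replicator_flow S u \<phi>" and x: "x \<in> open_face S A"
    and two: "s\<^sub>0 \<in> A i\<^sub>0" "t\<^sub>0 \<in> A i\<^sub>0" "s\<^sub>0 \<noteq> t\<^sub>0" and "0 < \<epsilon>" "0 < T"
  obtains j r b where "r \<in> A j" "b \<in> open_face S (A(j := A j - {r}))"
    "(time_step (mixed_profiles S) \<phi> \<epsilon> T)\<^sup>+\<^sup>+ x b"
proof -
  note A = open_face_support[OF x]
  define a where "a i = (SOME s. s \<in> A i)" for i
  have a: "a i \<in> A i" for i using A(1)[of i] by (auto simp: a_def intro: someI)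
  interpret shear_field "log_field S u A a" "2 * utility_bound S u" "8 * CARD('i) * utility_bound S u"
    using A by (rule shear_field_log_field)
  define c where "c = real (CARD('i) * CARD('s))"
  have c: "0 < c" by (simp add: c_def)
  \<comment> \<open>An error \<open>2 * \<eta>\<close> in the coordinates becomes
    \<open>8 * \<eta>\<close> in each probability and \<open>c * (8 * \<eta>)\<close>, a quarter of
    \<open>\<epsilon>\<close>, in distance.\<close>
  define \<eta> where "\<eta> = \<epsilon> / (32 * c)"
  have \<eta>: "0 < \<eta>" "c * (8 * \<eta>) < \<epsilon> / 2" using \<open>0 < \<epsilon>\<close> c by (auto simp: \<eta>_def)
  obtain \<delta> P where \<delta>: "0 < \<delta>" "\<delta> < \<eta>" and "inj P"
    and fixed: "\<And>k i s. (\<And>y. log_field S u A a y i s = 0) \<Longrightarrow> P k i s = k i s"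
    and approx: "\<And>y k i s. solution T y \<Longrightarrow> y 0 = grid \<delta> k \<Longrightarrow> \<bar>grid \<delta> (P k) i s - y T i s\<bar> \<le> \<eta>"
    using lattice_approximation[OF \<open>0 < T\<close> \<eta>(1)] by metis
  \<comment> \<open>The coordinates that can vary. Of the two strategies \<open>s\<^sub>0\<close>
    and \<open>t\<^sub>0\<close> at most one is the reference strategy.\<close>
  define I where "I = {(i, s). s \<in> A i \<and> s \<noteq> a i}"
  have "(i\<^sub>0, s\<^sub>0) \<in> I \<or> (i\<^sub>0, t\<^sub>0) \<in> I" using two by (auto simp: I_def)
  then have "I \<noteq> {}" by blast
  have inv: "P k i s = k i s" if "(i, s) \<notin> I" for k i s
    using that by (intro fixed) (auto simp: I_def log_field_def)
  define Y where "Y k = softmax A (grid \<delta> k)" for k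
  have Y: "Y k \<in> open_face S A" for k unfolding Y_def by (rule softmax_open_face[OF A])
  have step: "time_step (mixed_profiles S) \<phi> (\<epsilon> / 2) T z (Y l)"
    if z: "z \<in> open_face S A" and close: "\<And>i s. \<bar>grid \<delta> l i s - log_coords A a (\<phi> z T) i s\<bar> \<le> 2 * \<eta>" for z l
  proof -
    have face: "\<phi> z T \<in> open_face S A" using replicator_flow_open_face[OF flow z] \<open>0 < T\<close> by simp
    have "\<bar>softmax A (log_coords A a (\<phi> z T)) $ i $ s - Y l $ i $ s\<bar> \<le> 4 * (2 * \<eta>)" for i s
      unfolding Y_def by (rule softmax_lipschitz[OF A(1)]) (use close in \<open>simp add: abs_minus_commute\<close>)
    then have "dist (\<phi> z T) (Y l) \<le> c * (8 * \<eta>)"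
      unfolding c_def softmax_log_coords[OF face a] by (intro dist_le_entries) simp
    then have "dist (\<phi> z T) (Y l) < \<epsilon> / 2" using \<eta> by linarith
    then show ?thesis using z Y[of l] by (simp add: time_step_def open_face_def)
  qed
  \<comment> \<open>The first jump, after time \<open>T\<close>, moves onto the lattice;
    \<open>x\<close> itself need not correspond to a lattice point.\<close>
  define k\<^sub>0 where "k\<^sub>0 i s = \<lfloor>log_coords A a (\<phi> x T) i s / \<delta>\<rfloor>" for i s
  have k0: "k\<^sub>0 i s = 0" if "(i, s) \<notin> I" for i s
    using that by (auto simp: k\<^sub>0_def log_coords_def I_def)
  have start: "time_step (mixed_profiles S) \<phi> (\<epsilon> / 2) T x (Y k\<^sub>0)"
  proof (rule step[OF x])
    fix i s
    define w where "w = log_coords A a (\<phi> x T) i s / \<delta>"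
    have "grid \<delta> k\<^sub>0 i s - log_coords A a (\<phi> x T) i s = \<delta> * (\<lfloor>w\<rfloor> - w)"
      using \<delta> by (simp add: grid_def k\<^sub>0_def w_def right_diff_distrib)
    also have "\<bar>\<dots>\<bar> = \<delta> * \<bar>\<lfloor>w\<rfloor> - w\<bar>" using \<delta> by (simp add: abs_mult)
    also have "\<dots> \<le> \<delta> * 1"
    proof (rule mult_left_mono)
      show "\<bar>\<lfloor>w\<rfloor> - w\<bar> \<le> 1" by linarith
    qed (use \<delta> in simp)
    finally show "\<bar>grid \<delta> k\<^sub>0 i s - log_coords A a (\<phi> x T) i s\<bar> \<le> 2 * \<eta>" using \<delta> by linarith
  qed
  define drift where "drift = (\<lambda>k l. (\<forall>i s. \<bar>l i s - P k i s\<bar> \<le> 1) \<and> (\<forall>i s. (i, s) \<notin> I \<longrightarrow> l i s = 0))"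
  have drift_step: "time_step (mixed_profiles S) \<phi> (\<epsilon> / 2) T (Y k) (Y l)"
    if supp: "\<And>i s. (i, s) \<notin> I \<Longrightarrow> k i s = 0" and kl: "drift k l" for k l
  proof (rule step[OF Y])
    fix i s
    have "log_coords A a (Y k) = grid \<delta> k"
      unfolding Y_def by (rule log_coords_softmax[OF a]) (auto simp: grid_def supp I_def)
    moreover have "\<phi> (Y k) 0 = Y k"
      using replicator_flowD(1)[OF flow] Y[of k] by (simp add: open_face_def)
    ultimately have "\<bar>grid \<delta> (P k) i s - log_coords A a (\<phi> (Y k) T) i s\<bar> \<le> \<eta>"
      using approx[OF log_coords_solution[OF flow Y a]] by simp
    moreover have "\<bar>grid \<delta> l i s - grid \<delta> (P k) i s\<bar> \<le> \<delta>"
    proof -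
      have "\<bar>l i s - P k i s\<bar> \<le> 1" using kl unfolding drift_def by blast
      then have "\<bar>real_of_int (l i s - P k i s)\<bar> \<le> 1" by linarith
      then have "\<delta> * \<bar>real_of_int (l i s - P k i s)\<bar> \<le> \<delta> * 1" using \<delta> by (intro mult_left_mono) auto
      then show ?thesis using \<delta> by (simp add: grid_def abs_mult flip: right_diff_distrib)
    qed
    ultimately show "\<bar>grid \<delta> l i s - log_coords A a (\<phi> (Y k) T) i s\<bar> \<le> 2 * \<eta>" using \<delta> by linarith
  qed
  \<comment> \<open>Chosen so that \<open>M < \<bar>k i s\<bar>\<close> gives \<open>exp (- \<delta>
    * \<bar>k i s\<bar>) \<le> \<epsilon> / (2 * c)\<close>.\<close>
  define M where "M = \<lceil>ln (2 * c / \<epsilon>) / \<delta>\<rceil>"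
  obtain k i s where reach: "drift\<^sup>*\<^sup>* k\<^sub>0 k" and is_I: "(i, s) \<in> I" and large: "M < \<bar>k i s\<bar>"
    by (rule lattice_drift_unbounded[where k\<^sub>0 = k\<^sub>0 and M = M, OF \<open>inj P\<close> inv \<open>I \<noteq> {}\<close> k0,
          folded drift_def])
  from reach have "(time_step (mixed_profiles S) \<phi> (\<epsilon> / 2) T)\<^sup>+\<^sup>+ x (Y k) \<and> (\<forall>i s. (i, s) \<notin> I \<longrightarrow> k i s = 0)"
  proof induction
    case base
    then show ?case using start k0 by auto
  next
    case (step k l)
    then have "time_step (mixed_profiles S) \<phi> (\<epsilon> / 2) T (Y k) (Y l)" by (intro drift_step) auto
    with step show ?case by (auto simp: drift_def intro: tranclp.trancl_into_trancl)
  qed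
  then have chain: "(time_step (mixed_profiles S) \<phi> (\<epsilon> / 2) T)\<^sup>+\<^sup>+ x (Y k)"
    and supp: "\<And>i s. (i, s) \<notin> I \<Longrightarrow> k i s = 0" by blast+
  have "exp (- \<delta> * \<bar>k i s\<bar>) \<le> \<epsilon> / (2 * c)"
  proof -
    have "ln (2 * c / \<epsilon>) / \<delta> \<le> \<bar>k i s\<bar>" using large unfolding M_def by linarith
    then have "ln (2 * c / \<epsilon>) \<le> \<delta> * \<bar>k i s\<bar>" using \<delta> by (simp add: field_simps)
    then have "exp (- (\<delta> * \<bar>k i s\<bar>)) \<le> exp (- ln (2 * c / \<epsilon>))" by simp
    also have "\<dots> = \<epsilon> / (2 * c)" using \<open>0 < \<epsilon>\<close> c by (simp add: exp_minus)
    finally show ?thesis by simp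
  qed
  moreover have sA: "s \<in> A i" "s \<noteq> a i" using is_I by (auto simp: I_def)
  moreover have "k i (a i) = 0" using supp by (simp add: I_def)
  \<comment> \<open>The reference coordinate is 0, so the sign of \<open>k i s\<close> decides which
    of \<open>s\<close> and \<open>a i\<close> is the rare strategy \<open>r\<close>.\<close>
  ultimately obtain r t where rt: "r \<in> A i" "t \<in> A i" "r \<noteq> t" "exp (\<delta> * k i r - \<delta> * k i t) \<le> \<epsilon> / (2 * c)"
  proof (cases "0 \<le> k i s")
    case True
    then show ?thesis using that[of "a i" s] a[of i] \<open>k i (a i) = 0\<close> sA \<open>exp _ \<le> _\<close> by auto
  next
    case False
    then show ?thesis using that[of s "a i"] a[of i] \<open>k i (a i) = 0\<close> sA \<open>exp _ \<le> _\<close> by auto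
  qed
  have "Y k $ i $ r \<le> \<epsilon> / (2 * c)"
    using softmax_le_exp_diff[of t A i "grid \<delta> k" r] rt(2) rt(4) by (simp add: Y_def grid_def)
  then have small: "c * Y k $ i $ r \<le> \<epsilon> / 2" using c by (simp add: field_simps)
  obtain b where b: "b \<in> open_face S (A(i := A i - {r}))" "dist (Y k) b \<le> c * Y k $ i $ r"
    using open_face_remove[OF Y rt(1-3)] unfolding c_def by blast
  \<comment> \<open>One half of \<open>\<epsilon>\<close> pays for the lattice chain, the other for
    the landing on the boundary.\<close>
  have "(time_step (mixed_profiles S) \<phi> (\<epsilon> / 2 + \<epsilon> / 2) T)\<^sup>+\<^sup>+ x b"
    using b small \<open>0 < \<epsilon>\<close> by (intro time_step_perturb_last[OF chain]) (auto simp: open_face_def)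
  then show thesis using that rt(1) b(1) by simp
qed

section \<open>Vertices and the descent to them\<close>

lemma pure_vertex_open_face:
  assumes "q \<in> pure_profiles S"
  shows "pure_vertex q \<in> open_face S (\<lambda>i. {q i})"
proof -
  have "(\<Sum>s\<in>S i. axis (q i) (1::real) $ s) = 1" for i
    using assms by (simp add: axis_def pure_profiles_def)
  then show ?thesis using assms
    by (auto simp: open_face_def mixed_profiles_def pure_vertex_def pure_profiles_def axis_def)
qed

lemma open_face_singleton:
  assumes x: "x \<in> open_face S A" and sub: "\<And>i. A i \<subseteq> {q i}"
  shows "x = pure_vertex q" "q \<in> pure_profiles S"
proof -
  have A: "A i = {q i}" for i using sub[of i] open_face_support(1)[OF x, of i] by auto
  then show "q \<in> pure_profiles S" using open_face_support(2)[OF x] by (simp add: pure_profiles_def)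
  have "x $ i $ s = pure_vertex q $ i $ s" for i s
    using open_face_sum[OF x open_face_support(2)[OF x], of i] open_face_outside[OF x, of s i]
    by (auto simp: A pure_vertex_def axis_def)
  then show "x = pure_vertex q" by (simp add: vec_eq_iff)
qed

text \<open>A vertex is an open face by itself, so invariance of faces makes it a fixed
  point.\<close>

lemma replicator_flow_pure_vertex:
  assumes "replicator_flow S u \<phi>" "q \<in> pure_profiles S" "0 \<le> t"
  shows "\<phi> (pure_vertex q) t = pure_vertex q"
  using open_face_singleton(1)[OF replicator_flow_open_face[OF assms(1) pure_vertex_open_face[OF assms(2)] assms(3)]]
  by simp

lemma time_step_pure_vertex:
  assumes "replicator_flow S u \<phi>" "q \<in> pure_profiles S" "0 < \<epsilon>" "0 < T"
  shows "time_step (mixed_profiles S) \<phi> \<epsilon> T (pure_vertex q) (pure_vertex q)"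
  using assms pure_vertex_open_face[OF assms(2)]
  by (simp add: time_step_def replicator_flow_pure_vertex open_face_def)

text \<open>Induction on the total size of the support. The condition that all profiles in the
  support lie in \<open>W\<close> passes to smaller faces, so the vertex reached at the end lies in
  \<open>W\<close>.\<close>

lemma chain_to_pure_vertex:
  fixes x :: "real ^ 's::finite ^ 'i::finite"
  assumes flow: "replicator_flow S u \<phi>" and "0 < \<epsilon>" "0 < T" and "x \<in> profile_content S W"
  obtains v where "v \<in> W" "(time_step (mixed_profiles S) \<phi> \<epsilon> T)\<^sup>+\<^sup>+ x (pure_vertex v)"
proof -
  have main: "\<exists>v\<in>W. (time_step (mixed_profiles S) \<phi> \<epsilon> T)\<^sup>+\<^sup>+ x (pure_vertex v)"
    if "x \<in> open_face S A" "\<And>q. (\<And>i. q i \<in> A i) \<Longrightarrow> q \<in> W" for x A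
    using that
  proof (induction "\<Sum>i\<in>UNIV. card (A i)" arbitrary: x A rule: less_induct)
    case less
    show ?case
    proof (cases "\<exists>i s t. s \<in> A i \<and> t \<in> A i \<and> s \<noteq> t")
      case True
      then obtain i s t where "s \<in> A i" "t \<in> A i" "s \<noteq> t" by blast
      from chain_to_smaller_face[OF flow less.prems(1) this \<open>0 < \<epsilon>\<close> \<open>0 < T\<close>]
      obtain j r b where r: "r \<in> A j" and b: "b \<in> open_face S (A(j := A j - {r}))"
        and chain: "(time_step (mixed_profiles S) \<phi> \<epsilon> T)\<^sup>+\<^sup>+ x b" by metis
      have "(\<Sum>i\<in>UNIV. card ((A(j := A j - {r})) i)) < (\<Sum>i\<in>UNIV. card (A i))"
      proof (rule sum_strict_mono_ex1)
        show "\<forall>i\<in>UNIV. card ((A(j := A j - {r})) i) \<le> card (A i)" by (simp add: card_mono)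
        show "\<exists>i\<in>UNIV. card ((A(j := A j - {r})) i) < card (A i)"
          using card_Diff1_less[OF _ r] by (intro bexI[of _ j]) (simp_all only: fun_upd_same finite UNIV_I)
      qed simp
      moreover have "q \<in> W" if "\<And>i. q i \<in> (A(j := A j - {r})) i" for q
      proof (rule less.prems(2))
        show "q i \<in> A i" for i using that[of i] by (auto split: if_splits)
      qed
      ultimately obtain v where "v \<in> W" "(time_step (mixed_profiles S) \<phi> \<epsilon> T)\<^sup>+\<^sup>+ b (pure_vertex v)"
        using less.hyps[OF _ b] by blast
      with chain show ?thesis by (blast intro: tranclp_trans)
    next
      case False
      define q where "q i = (SOME s. s \<in> A i)" for i
      have q: "q i \<in> A i" for i using open_face_support(1)[OF less.prems(1), of i] by (auto simp: q_def intro: someI)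
      have "A i \<subseteq> {q i}" for i using False q by blast
      from open_face_singleton[OF less.prems(1) this]
      have "x = pure_vertex q" "q \<in> pure_profiles S" .
      then show ?thesis
        using time_step_pure_vertex[OF flow _ \<open>0 < \<epsilon>\<close> \<open>0 < T\<close>] less.prems(2) q by blast
    qed
  qed
  define A where "A i = {s. 0 < x $ i $ s}" for i
  have x: "x \<in> open_face S A" using assms(4) by (simp add: open_face_def profile_content_def A_def)
  have "q \<in> W" if "\<And>i. q i \<in> A i" for q
    using assms(4) that open_face_support(2)[OF x] unfolding profile_content_def pure_profiles_def A_def by blast
  from main[OF x this] show thesis using that by blast
qed

section \<open>Compactness of the strategy space and time reversal\<close>

lemma closed_mixed_profiles: "closed (mixed_profiles S)"
proof -
  have "mixed_profiles S = (\<Inter>i. (\<Inter>s\<in>S i. {x. 0 \<le> x $ i $ s}) \<inter> (\<Inter>s\<in>- S i. {x. x $ i $ s = 0})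
      \<inter> {x. (\<Sum>s\<in>S i. x $ i $ s) = 1})"
    by (auto simp: mixed_profiles_def)
  also have "closed \<dots>"
    by (intro closed_INT ballI closed_Int closed_Collect_le closed_Collect_eq continuous_intros)
  finally show ?thesis .
qed

lemma compact_mixed_profiles: "compact (mixed_profiles (S :: 'i::finite \<Rightarrow> 's::finite set))"
proof -
  have "dist 0 x \<le> real (CARD('i) * CARD('s)) * 1" if "x \<in> mixed_profiles S" for x
    using mixed_profiles_nth_bounds[OF that] by (intro dist_le_entries) simp
  then have "bounded (mixed_profiles S)" unfolding bounded_def by blast
  then show ?thesis using closed_mixed_profiles compact_eq_bounded_closed by blast
qed

lemma strategy_utility_uminus:
  "strategy_utility S (\<lambda>q. - u q) p s x = - strategy_utility S u p s x"
  by (simp add: strategy_utility_eq sum_negf)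

lemma replicator_flow_continuous:
  assumes "replicator_flow S u \<phi>" "continuous_on A f" "continuous_on A g" "f ` A \<subseteq> mixed_profiles S"
  shows "continuous_on A (\<lambda>z. \<phi> (f z) (g z))"
proof -
  have "continuous_on (mixed_profiles S \<times> UNIV) (\<lambda>(x, t). \<phi> x t)"
    using assms(1) by (simp add: replicator_flow_def)
  from continuous_on_compose2[OF this continuous_on_Pair[OF assms(2,3)]] show ?thesis
    using assms(4) by auto
qed

text \<open>The replicator field is linear in the utilities, so reversing time amounts to negating
  \<open>u\<close>. The content of a set does not depend on \<open>u\<close>.\<close>

lemma replicator_flow_reverse:
  assumes flow: "replicator_flow S u \<phi>"
  shows "replicator_flow S (\<lambda>q. - u q) (\<lambda>x t. \<phi> x (- t))"
  unfolding replicator_flow_def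
proof (intro conjI ballI allI)
  have field: "replicator_field S (\<lambda>q. - u q) x = - replicator_field S u x" for x
    by (simp add: replicator_field_def strategy_utility_uminus vec_eq_iff sum_negf algebra_simps)
  show "continuous_on (mixed_profiles S \<times> UNIV) (\<lambda>(x, t). \<phi> x (- t))"
    unfolding case_prod_beta
    by (intro replicator_flow_continuous[OF flow] continuous_intros) auto
  fix x assume x: "x \<in> mixed_profiles S"
  note [simp] = replicator_flowD(1,3)[OF flow x]
  show "\<phi> x (- 0) = x" by simp
  show "\<phi> x (- (s + t)) = \<phi> (\<phi> x (- s)) (- t)" for s t
    using replicator_flowD(2)[OF flow x, of "- s" "- t"] by simp
  show "\<phi> x (- t) \<in> mixed_profiles S" for t by simp
  fix t
  have "(\<phi> x \<circ> uminus has_vector_derivative (- 1) *\<^sub>R replicator_field S u (\<phi> x (- t))) (at t)"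
    by (intro vector_diff_chain_at) (auto intro!: derivative_eq_intros replicator_flowD(4)[OF flow x])
  then show "((\<lambda>t. \<phi> x (- t)) has_vector_derivative replicator_field S (\<lambda>q. - u q) (\<phi> x (- t))) (at t)"
    by (simp add: field o_def)
qed

lemma chain_from_pure_vertex:
  fixes x :: "real ^ 's::finite ^ 'i::finite"
  assumes flow: "replicator_flow S u \<phi>" and "0 < \<epsilon>" "0 < T" and x: "x \<in> profile_content S W"
  obtains v where "v \<in> W" "(time_step (mixed_profiles S) \<phi> \<epsilon> T)\<^sup>+\<^sup>+ (pure_vertex v) x"
proof -
  let ?X = "mixed_profiles S"
  have "continuous_on ?X (\<lambda>x. \<phi> x T)"
    by (intro replicator_flow_continuous[OF flow] continuous_intros) auto
  then have "uniformly_continuous_on ?X (\<lambda>x. \<phi> x T)"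
    by (intro compact_uniformly_continuous compact_mixed_profiles) simp
  then obtain d where "0 < d"
    and d: "\<And>a b. a \<in> ?X \<Longrightarrow> b \<in> ?X \<Longrightarrow> dist a b < d \<Longrightarrow> dist (\<phi> a T) (\<phi> b T) < \<epsilon>"
    using \<open>0 < \<epsilon>\<close> by (rule uniformly_continuous_onE) blast
  obtain v where v: "v \<in> W" "(time_step ?X (\<lambda>x t. \<phi> x (- t)) d T)\<^sup>+\<^sup>+ x (pure_vertex v)"
    using chain_to_pure_vertex[OF replicator_flow_reverse[OF flow] \<open>0 < d\<close> \<open>0 < T\<close> x] .
  \<comment> \<open>If \<open>\<phi> a (- T)\<close> is within \<open>d\<close> of \<open>b\<close>,
    then flowing both for time \<open>T\<close> puts \<open>a\<close> within
    \<open>\<epsilon>\<close> of \<open>\<phi> b T\<close>: each backward jump read in reverse is a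
    forward jump.\<close>
  have "(time_step ?X \<phi> \<epsilon> T)\<inverse>\<inverse> a b" if "time_step ?X (\<lambda>x t. \<phi> x (- t)) d T a b" for a b
  proof -
    have a: "a \<in> ?X" "b \<in> ?X" "dist (\<phi> a (- T)) b < d" using that by (auto simp: time_step_def)
    moreover have "\<phi> (\<phi> a (- T)) T = a"
      using replicator_flowD(1)[OF flow a(1)] replicator_flowD(2)[OF flow a(1), of "- T" T] by simp
    ultimately have "dist a (\<phi> b T) < \<epsilon>" using d[of "\<phi> a (- T)" b] replicator_flowD(3)[OF flow a(1)] by metis
    then show ?thesis using a by (simp add: time_step_def dist_commute)
  qed
  with v(2) have "((time_step ?X \<phi> \<epsilon> T)\<inverse>\<inverse>)\<^sup>+\<^sup>+ x (pure_vertex v)" by (rule tranclp_mono_pred)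
  then have "(time_step ?X \<phi> \<epsilon> T)\<^sup>+\<^sup>+ (pure_vertex v) x" by (simp add: tranclp_converse)
  with v(1) show thesis by (rule that)
qed

section \<open>Chains and edges of the response graph\<close>

text \<open>The requirement \<open>2 \<le> n\<close> means at least one jump, hence the transitive
  and not the reflexive transitive closure. In this form concatenation of chains is
  immediate.\<close>

lemma is_chain_iff_tranclp:
  "is_chain X \<phi> \<epsilon> T x y \<longleftrightarrow> (\<lambda>x y. x \<in> X \<and> y \<in> X \<and> (\<exists>t\<ge>T. dist (\<phi> x t) y < \<epsilon>))\<^sup>+\<^sup>+ x y"
    (is "_ \<longleftrightarrow> ?r\<^sup>+\<^sup>+ x y")
proof
  assume "is_chain X \<phi> \<epsilon> T x y"
  then obtain n :: nat and z t where n: "2 \<le> n" "z 1 = x" "z n = y" and X: "\<forall>i\<in>{1..n}. z i \<in> X"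
    and dist: "\<forall>i\<in>{1..n - 1}. T \<le> t i \<and> dist (\<phi> (z i) (t i)) (z (i + 1)) < \<epsilon>"
    unfolding is_chain_def by blast
  have r: "?r (z i) (z (Suc i))" if "1 \<le> i" "Suc i \<le> n" for i
    using that X dist by auto
  have "?r\<^sup>+\<^sup>+ (z 1) (z n)" using n(1)
  proof (induction rule: dec_induct)
    case base
    then show ?case using r[of 1] n(1) by (simp add: numeral_2_eq_2 tranclp.r_into_trancl)
  next
    case (step m)
    then show ?case using r[of m] by (auto intro: tranclp.trancl_into_trancl)
  qed
  then show "?r\<^sup>+\<^sup>+ x y" using n by simp
next
  assume "?r\<^sup>+\<^sup>+ x y"
  then show "is_chain X \<phi> \<epsilon> T x y"
  proof induction
    case (base y)
    then obtain t where "T \<le> t" "dist (\<phi> x t) y < \<epsilon>" "x \<in> X" "y \<in> X" by blast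
    then show ?case unfolding is_chain_def
      by (intro exI[of _ 2] exI[of _ "\<lambda>i. if i = 1 then x else y"] exI[of _ "\<lambda>_. t"]) auto
  next
    case (step y w)
    from step.IH obtain n :: nat and z t where n: "2 \<le> n" "z 1 = x" "z n = y" and X: "\<forall>i\<in>{1..n}. z i \<in> X"
      and dist: "\<forall>i\<in>{1..n - 1}. T \<le> t i \<and> dist (\<phi> (z i) (t i)) (z (i + 1)) < \<epsilon>"
      unfolding is_chain_def by blast
    from step.hyps obtain t' where t': "T \<le> t'" "dist (\<phi> y t') w < \<epsilon>" "w \<in> X" by blast
    let ?z = "z(Suc n := w)" and ?t = "t(n := t')"
    have "T \<le> ?t i \<and> dist (\<phi> (?z i) (?t i)) (?z (i + 1)) < \<epsilon>" if "i \<in> {1..Suc n - 1}" for i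
      using that dist t' n by (cases "i = n") auto
    moreover have "\<forall>i\<in>{1..Suc n}. ?z i \<in> X" using X t' by auto
    ultimately show ?case unfolding is_chain_def using n
      by (intro exI[of _ "Suc n"] exI[of _ ?z] exI[of _ ?t]) auto
  qed
qed

lemma is_chain_trans:
  "is_chain X \<phi> \<epsilon> T x y \<Longrightarrow> is_chain X \<phi> \<epsilon> T y z \<Longrightarrow> is_chain X \<phi> \<epsilon> T x z"
  unfolding is_chain_iff_tranclp by (rule tranclp_trans)

lemma pseudo_orbit_trans:
  "pseudo_orbit X \<phi> x y \<Longrightarrow> pseudo_orbit X \<phi> y z \<Longrightarrow> pseudo_orbit X \<phi> x z"
  unfolding pseudo_orbit_def using is_chain_trans[of X \<phi> _ _ x y z] by simp

lemma is_chain_time_steps: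
  "(time_step X \<phi> \<epsilon> T)\<^sup>+\<^sup>+ x y \<Longrightarrow> is_chain X \<phi> \<epsilon> T x y"
  unfolding is_chain_iff_tranclp by (erule tranclp_mono_pred) (auto simp: time_step_def)

lemma expected_utility_pure_vertex:
  assumes "q \<in> pure_profiles S"
  shows "expected_utility S u (pure_vertex q) = u q"
proof -
  have "(\<Prod>i\<in>UNIV. pure_vertex q $ i $ r i) = (if r = q then 1 else 0)" for r :: "'a \<Rightarrow> 'b"
    by (auto simp: pure_vertex_def axis_def fun_eq_iff intro!: prod.neutral prod_zero)
  then show ?thesis using assms
    by (simp add: expected_utility_def if_distrib[of "\<lambda>c. c *\<^sub>R _"] sum.delta cong: if_cong)
qed

section \<open>The flow along one arc of the response graph\<close>

definition edge_point ::
  "'i \<Rightarrow> ('i::finite \<Rightarrow> 's::finite) \<Rightarrow> ('i \<Rightarrow> 's) \<Rightarrow> real \<Rightarrow> real ^ 's ^ 'i" where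
  "edge_point i p q l = (1 - l) *\<^sub>R pure_vertex p + l *\<^sub>R pure_vertex q"

context
  fixes S :: "'i::finite \<Rightarrow> 's::finite set" and u :: "('i \<Rightarrow> 's) \<Rightarrow> real ^ 'i"
    and \<phi> :: "real ^ 's ^ 'i \<Rightarrow> real \<Rightarrow> real ^ 's ^ 'i" and i :: 'i and p q :: "'i \<Rightarrow> 's"
  assumes flow: "replicator_flow S u \<phi>" and p: "p \<in> pure_profiles S" and q: "q \<in> pure_profiles S"
    and pq: "comparable i p q" and le: "u p $ i \<le> u q $ i"
begin

lemma edge_point_nth:
  "edge_point i p q l $ j $ s = (if j = i then if s = q i then l else if s = p i then 1 - l else 0
     else if s = q j then 1 else 0)"
proof -
  have "p i \<noteq> q i" "j \<noteq> i \<Longrightarrow> p j = q j" using pq by (simp_all add: comparable_def)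
  then show ?thesis by (cases "j = i") (simp_all add: edge_point_def pure_vertex_def axis_def)
qed

lemma edge_point_mixed:
  assumes "0 \<le> l" "l \<le> 1"
  shows "edge_point i p q l \<in> mixed_profiles S"
proof -
  have "pure_vertex p \<in> mixed_profiles S" "pure_vertex q \<in> mixed_profiles S"
    using pure_vertex_open_face p q by (auto simp: open_face_def)
  then show ?thesis using assms
    by (auto simp: edge_point_def mixed_profiles_def sum.distrib simp flip: sum_distrib_left)
qed

definition edge_support :: "'i \<Rightarrow> 's set" where
  "edge_support j = (if j = i then {p i, q i} else {q j})"

lemma edge_point_face:
  assumes "0 < l" "l < 1"
  shows "edge_point i p q l \<in> open_face S edge_support"
proof -
  have "p i \<noteq> q i" using pq by (simp add: comparable_def)
  then have "0 < edge_point i p q l $ j $ s \<longleftrightarrow> s \<in> edge_support j" for j s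
    using assms by (cases "j = i") (simp_all add: edge_point_nth edge_support_def)
  then show ?thesis using edge_point_mixed[of l] assms by (simp add: open_face_def)
qed

lemma edge_face_point:
  assumes "x \<in> open_face S edge_support"
  shows "x = edge_point i p q (x $ i $ q i)" "0 < x $ i $ q i" "x $ i $ q i < 1"
proof -
  have sum: "(\<Sum>s\<in>edge_support j. x $ j $ s) = 1" for j
    by (rule open_face_sum[OF assms open_face_support(2)[OF assms]])
  have ne: "p i \<noteq> q i" using pq by (simp add: comparable_def)
  have i: "x $ i $ p i + x $ i $ q i = 1" using sum[of i] ne by (simp add: edge_support_def)
  have "x $ j $ s = edge_point i p q (x $ i $ q i) $ j $ s" for j s
  proof (cases "s \<in> edge_support j")
    case True
    have "x $ i $ p i = 1 - x $ i $ q i" using i by linarith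
    then show ?thesis using sum[of j] ne True by (auto simp: edge_point_nth edge_support_def split: if_splits)
  next
    case False
    then have "edge_point i p q l $ j $ s = 0" for l
      by (cases "j = i") (simp_all add: edge_point_nth edge_support_def)
    then show ?thesis unfolding open_face_outside[OF assms False] by simp
  qed
  then show "x = edge_point i p q (x $ i $ q i)" unfolding vec_eq_iff by blast
  have "0 < x $ i $ q i" "0 < x $ i $ p i" using assms by (auto simp: open_face_def edge_support_def)
  then show "0 < x $ i $ q i" "x $ i $ q i < 1" using i by linarith+
qed

text \<open>On the edge the others play as in \<open>q\<close>, so with weight \<open>l\<close> on
  \<open>q i\<close> the growth rate is \<open>(1 - l) * (u q $ i - u p $ i)\<close>.\<close>

lemma edge_growth_nonneg:
  assumes "x \<in> open_face S edge_support"
  shows "0 \<le> growth_rate S u i (q i) x"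
proof -
  define l where "l = x $ i $ q i"
  have x: "x = edge_point i p q l" and l: "0 < l" "l < 1"
    using edge_face_point[OF assms] by (auto simp: l_def)
  have ne: "p i \<noteq> q i" and eq: "\<And>j. j \<noteq> i \<Longrightarrow> p j = q j" using pq by (auto simp: comparable_def)
  have U: "strategy_utility S u i (r i) x = u r $ i" if "r \<in> pure_profiles S" "\<And>j. j \<noteq> i \<Longrightarrow> r j = q j" for r
  proof -
    have "(\<chi> j. if j = i then axis (r i) 1 else x $ j) = pure_vertex r"
      using that by (auto simp: vec_eq_iff x edge_point_nth pure_vertex_def axis_def)
    then show ?thesis using that by (simp add: strategy_utility_def expected_utility_pure_vertex)
  qed
  have "(\<Sum>t\<in>S i. x $ i $ t * strategy_utility S u i t x) = (\<Sum>t\<in>{p i, q i}. x $ i $ t * strategy_utility S u i t x)"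
    using p q by (intro sum.mono_neutral_right) (auto simp: x edge_point_nth pure_profiles_def)
  also have "\<dots> = (1 - l) * u p $ i + l * u q $ i"
    using ne U[OF p eq] U[OF q] by (simp add: x edge_point_nth)
  finally have "growth_rate S u i (q i) x = (1 - l) * (u q $ i - u p $ i)"
    using U[OF q] by (simp add: growth_rate_def algebra_simps)
  then show ?thesis using l le by simp
qed

lemma edge_flow:
  assumes l: "0 \<le> l" "l \<le> 1" and "0 \<le> T"
  obtains m where "l \<le> m" "m \<le> 1" "\<phi> (edge_point i p q l) T = edge_point i p q m"
\<comment> \<open>The endpoints are fixed vertices outside the open edge;
  \<open>edge_growth_nonneg\<close> covers only interior points.\<close>
proof (cases "l = 0 \<or> l = 1")
  case True
  then have "\<phi> (edge_point i p q l) T = edge_point i p q l"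
    using replicator_flow_pure_vertex[OF flow p \<open>0 \<le> T\<close>] replicator_flow_pure_vertex[OF flow q \<open>0 \<le> T\<close>]
    by (auto simp: edge_point_def)
  then show thesis using that l by blast
next
  case False
  let ?x = "edge_point i p q l"
  have x: "?x \<in> open_face S edge_support" using l False by (intro edge_point_face) auto
  have X: "?x \<in> mixed_profiles S" using x by (simp add: open_face_def)
  have face: "\<phi> ?x t \<in> open_face S edge_support" if "0 \<le> t" for t
    by (rule replicator_flow_open_face[OF flow x that])
  have "\<phi> ?x 0 $ i $ q i \<le> \<phi> ?x T $ i $ q i"
  proof (rule DERIV_nonneg_imp_nondecreasing[OF \<open>0 \<le> T\<close>])
    show "\<exists>y. ((\<lambda>t. \<phi> ?x t $ i $ q i) has_real_derivative y) (at t) \<and> 0 \<le> y" if "0 \<le> t" for t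
    proof -
      have "0 \<le> \<phi> ?x t $ i $ q i * growth_rate S u i (q i) (\<phi> ?x t)"
        using edge_face_point(2)[OF face[OF that]] edge_growth_nonneg[OF face[OF that]] by simp
      then show ?thesis using replicator_flow_derivative[OF flow X, of i "q i" t] by blast
    qed
  qed
  then have "l \<le> \<phi> ?x T $ i $ q i"
    using replicator_flowD(1)[OF flow X] by (simp add: edge_point_nth)
  then show thesis
    using that[of "\<phi> ?x T $ i $ q i"] edge_face_point[OF face[OF \<open>0 \<le> T\<close>]] by simp
qed

text \<open>The flow never loses weight on \<open>q i\<close> and each jump adds \<open>d\<close>,
  so finitely many jumps arrive at \<open>q\<close> even if the two utilities are equal.\<close>

lemma pseudo_orbit_edge: "pseudo_orbit (mixed_profiles S) \<phi> (pure_vertex p) (pure_vertex q)"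
  unfolding pseudo_orbit_def
proof (intro allI impI)
  fix \<epsilon> T :: real assume "0 < \<epsilon>" "0 < T"
  define c where "c = real (CARD('i) * CARD('s))"
  have c: "0 < c" by (simp add: c_def)
  \<comment> \<open>Shifting the weight by \<open>d\<close> moves the point by at most
    \<open>c * d\<close>, which is half of \<open>\<epsilon>\<close>.\<close>
  define d where "d = \<epsilon> / (2 * c)"
  have d: "0 < d" "c * d < \<epsilon>" using c \<open>0 < \<epsilon>\<close> by (auto simp: d_def)
  let ?r = "time_step (mixed_profiles S) \<phi> \<epsilon> T" and ?e = "edge_point i p q"
  have climb: "\<exists>l. min 1 (real n * d) \<le> l \<and> l \<le> 1 \<and> ?r\<^sup>+\<^sup>+ (pure_vertex p) (?e l)" for n
  proof (induction n)
    case 0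
    have "?r (pure_vertex p) (?e 0)"
      using time_step_pure_vertex[OF flow p \<open>0 < \<epsilon>\<close> \<open>0 < T\<close>] by (simp add: edge_point_def)
    then show ?case by (intro exI[of _ 0]) auto
  next
    case (Suc n)
    then obtain l where l: "min 1 (real n * d) \<le> l" "l \<le> 1" "?r\<^sup>+\<^sup>+ (pure_vertex p) (?e l)" by blast
    have "0 \<le> min 1 (real n * d)" using d by simp
    then have "0 \<le> l" using l by linarith
    then obtain m where m: "l \<le> m" "m \<le> 1" "\<phi> (?e l) T = ?e m"
      using edge_flow[of l T] l \<open>0 < T\<close> by auto
    define k where "k = min 1 (m + d)"
    have k: "0 \<le> k" "k \<le> 1" "\<bar>m - k\<bar> \<le> d" using m d \<open>0 \<le> l\<close> by (auto simp: k_def)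
    have "dist (?e m) (?e k) \<le> c * d"
      unfolding c_def using k d by (intro dist_le_entries) (auto simp: edge_point_nth)
    then have "?r (?e l) (?e k)"
      using edge_point_mixed[of l] edge_point_mixed[of k] k l \<open>0 \<le> l\<close> m d by (simp add: time_step_def)
    moreover have "min 1 (real (Suc n) * d) \<le> k"
    proof -
      have "real (Suc n) * d = real n * d + d" by (simp add: algebra_simps)
      then show ?thesis using l(1) m(1) d(1) unfolding k_def min_def by (auto split: if_splits)
    qed
    ultimately show ?case using l k by (meson tranclp.trancl_into_trancl)
  qed
  obtain n where "1 / d < real n" using reals_Archimedean2 by blast
  then have "min 1 (real n * d) = 1" using d by (simp add: field_simps)
  with climb[of n] have "?r\<^sup>+\<^sup>+ (pure_vertex p) (?e 1)" by force
  then show "is_chain (mixed_profiles S) \<phi> \<epsilon> T (pure_vertex p) (pure_vertex q)"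
    by (intro is_chain_time_steps) (simp add: edge_point_def)
qed

end

section \<open>Chain components\<close>

text \<open>Chains along the arcs are concatenated. The empty path also needs a chain, which exists
  because vertices are fixed points.\<close>

lemma pseudo_orbit_reachable:
  assumes flow: "replicator_flow S u \<phi>" and "p \<rightarrow>\<^sup>*\<^bsub>with_proj (response_graph S u)\<^esub> q"
  shows "pseudo_orbit (mixed_profiles S) \<phi> (pure_vertex p) (pure_vertex q)"
proof -
  have refl: "pseudo_orbit (mixed_profiles S) \<phi> (pure_vertex q) (pure_vertex q)" if "q \<in> pure_profiles S" for q
    unfolding pseudo_orbit_def using time_step_pure_vertex[OF flow that]
    by (intro allI impI is_chain_time_steps tranclp.r_into_trancl)
  from assms(2) show ?thesis unfolding reachable_def
  proof (induction rule: rtrancl_on_induct)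
    case base
    then show ?case using refl by (simp add: response_graph_def with_proj_def)
  next
    case (step q r)
    then obtain i where "q \<in> pure_profiles S" "r \<in> pure_profiles S" "comparable i q r" "u q $ i \<le> u r $ i"
      by (auto simp: response_graph_def arcs_ends_def arc_to_ends_def with_proj_def)
    from pseudo_orbit_edge[OF flow this] step.IH show ?case by (blast intro: pseudo_orbit_trans)
  qed
qed

text \<open>The definite description is justified here: the class of \<open>v\<close> contains all
  of \<open>H\<close>, and every component that contains \<open>H\<close> contains \<open>v\<close>
  and so equals that class.\<close>

lemma chain_component_of_eq:
  assumes "v \<in> H" "\<And>w. w \<in> H \<Longrightarrow> chain_equivalent (mixed_profiles S) \<phi> (pure_vertex v) (pure_vertex w)"
    and "\<And>w. w \<in> H \<Longrightarrow> w \<in> pure_profiles S"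
  shows "chain_component_of S \<phi> H =
    {x \<in> chain_recurrent (mixed_profiles S) \<phi>. chain_equivalent (mixed_profiles S) \<phi> (pure_vertex v) x}"
proof -
  let ?X = "mixed_profiles S"
  let ?R = "{(x, y). x \<in> chain_recurrent ?X \<phi> \<and> y \<in> chain_recurrent ?X \<phi> \<and> chain_equivalent ?X \<phi> x y}"
  have sym: "chain_equivalent ?X \<phi> x y \<Longrightarrow> chain_equivalent ?X \<phi> y x" for x y
    by (simp add: chain_equivalent_def)
  have trans: "chain_equivalent ?X \<phi> x y \<Longrightarrow> chain_equivalent ?X \<phi> y z \<Longrightarrow> chain_equivalent ?X \<phi> x z" for x y z
    unfolding chain_equivalent_def by (blast intro: pseudo_orbit_trans)
  have rec: "pure_vertex w \<in> chain_recurrent ?X \<phi>" if "w \<in> H" for w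
    using pure_vertex_open_face[OF assms(3)[OF that]] trans[OF sym[OF assms(2)[OF that]] assms(2)[OF that]]
    by (simp add: chain_recurrent_def open_face_def)
  let ?C = "{x \<in> chain_recurrent ?X \<phi>. chain_equivalent ?X \<phi> (pure_vertex v) x}"
  have "?C = ?R `` {pure_vertex v}" using rec[OF assms(1)] by auto
  then have C: "?C \<in> chain_components ?X \<phi>"
    unfolding chain_components_def using rec[OF assms(1)] by (simp only: quotientI)
  have "D = ?C" if D: "D \<in> chain_components ?X \<phi>" "pure_vertex ` H \<subseteq> D" for D
  proof -
    obtain w where w: "w \<in> chain_recurrent ?X \<phi>" "D = ?R `` {w}"
      using D(1) unfolding chain_components_def by (rule quotientE)
    have "pure_vertex v \<in> D" using D(2) assms(1) by blast
    then have "chain_equivalent ?X \<phi> w (pure_vertex v)" using w by simp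
    then show ?thesis using w sym trans by blast
  qed
  then show ?thesis unfolding chain_component_of_def
    using C rec assms(2) by (intro the_equality) auto
qed

theorem theorem5p2:
  fixes S :: "'i::finite \<Rightarrow> 's::finite set"
    and u :: "('i \<Rightarrow> 's) \<Rightarrow> real ^ 'i"
    and \<phi> :: "real ^ 's ^ 'i \<Rightarrow> real \<Rightarrow> real ^ 's ^ 'i"
    and H :: "('i \<Rightarrow> 's) set"
  assumes "\<And>i. S i \<noteq> {}"
    and "replicator_flow S u \<phi>"
    and "H \<in> pre_digraph.sccs_verts (with_proj (response_graph S u))"
  shows "profile_content S H \<subseteq> chain_component_of S \<phi> H"
proof
  let ?G = "with_proj (response_graph S u)" and ?X = "mixed_profiles S"
  note flow = assms(2)
  have reach: "p \<rightarrow>\<^sup>*\<^bsub>?G\<^esub> q" if "p \<in> H" "q \<in> H" for p q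
    using assms(3) that unfolding pre_digraph.sccs_verts_def by blast+
  obtain v where v: "v \<in> H" using assms(3) unfolding pre_digraph.sccs_verts_def by blast
  have orbit: "pseudo_orbit ?X \<phi> (pure_vertex p) (pure_vertex q)" if "p \<in> H" "q \<in> H" for p q
    by (rule pseudo_orbit_reachable[OF flow reach[OF that]])
  have pure: "p \<in> pure_profiles S" if "p \<in> H" for p
  proof -
    have "p \<in> verts ?G" using reach[OF that that] by (rule reachable_in_vertsE)
    then show ?thesis by (simp add: response_graph_def with_proj_def)
  qed
  fix x assume x: "x \<in> profile_content S H"
  have "pseudo_orbit ?X \<phi> x (pure_vertex v)"
    unfolding pseudo_orbit_def
  proof (intro allI impI)
    fix \<epsilon> T :: real assume pos: "0 < \<epsilon>" "0 < T"
    \<comment> \<open>The vertex \<open>w\<close> may vary with \<open>\<epsilon>\<close> and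
      \<open>T\<close>; strong connectivity leads from any of them to the fixed
      \<open>v\<close>.\<close>
    obtain w where w: "w \<in> H" "(time_step ?X \<phi> \<epsilon> T)\<^sup>+\<^sup>+ x (pure_vertex w)"
      by (rule chain_to_pure_vertex[OF flow pos x])
    then show "is_chain ?X \<phi> \<epsilon> T x (pure_vertex v)"
      using orbit[OF w(1) v] pos unfolding pseudo_orbit_def
      by (blast intro: is_chain_trans is_chain_time_steps)
  qed
  moreover have "pseudo_orbit ?X \<phi> (pure_vertex v) x"
    unfolding pseudo_orbit_def
  proof (intro allI impI)
    fix \<epsilon> T :: real assume pos: "0 < \<epsilon>" "0 < T"
    obtain w where w: "w \<in> H" "(time_step ?X \<phi> \<epsilon> T)\<^sup>+\<^sup>+ (pure_vertex w) x"
      by (rule chain_from_pure_vertex[OF flow pos x])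
    then show "is_chain ?X \<phi> \<epsilon> T (pure_vertex v) x"
      using orbit[OF v w(1)] pos unfolding pseudo_orbit_def
      by (blast intro: is_chain_trans is_chain_time_steps)
  qed
  \<comment> \<open>Recurrence of \<open>x\<close> comes from the round trip through
    \<open>v\<close>.\<close>
  ultimately have "chain_equivalent ?X \<phi> (pure_vertex v) x" "chain_equivalent ?X \<phi> x x"
    unfolding chain_equivalent_def by (blast intro: pseudo_orbit_trans)+
  moreover have "x \<in> ?X" using x by (simp add: profile_content_def)
  moreover have "chain_component_of S \<phi> H =
    {x \<in> chain_recurrent ?X \<phi>. chain_equivalent ?X \<phi> (pure_vertex v) x}"
    using v orbit pure by (intro chain_component_of_eq) (auto simp: chain_equivalent_def)
  ultimately show "x \<in> chain_component_of S \<phi> H" by (simp add: chain_recurrent_def)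
qed

end
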